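(* Let $n\ge 0$ be an integer, $\nu=2n+1$, $\omega\in\mathbb{Z}$, $m=2(n^2+n+1)$ and $\mu=2m+1=\nu^2+4$. Let $\Phi$ consist of the following primaries: $0,\mathfrak{b}$; $\mathfrak{a}_i$ ($1\le i\le n$); $\mathfrak{c}_{h,j}$ ($1\le h\le n$, $0\le j<\nu$); $\mathfrak{d}_l$ ($1\le l\le m$). Let $T$ be the diagonal matrix with $$T_{0,0}=T_{\mathfrak{b},\mathfrak{b}}=T_{\mathfrak{a}_i,\mathfrak{a}_i}=1,\quad T_{\mathfrak{c}_{h,j},\mathfrak{c}_{h,j}}=\exp[2\pi \mathrm{i}(\omega h^2+\nu hj)/\nu^2],\quad T_{\mathfrak{d}_l,\mathfrak{d}_l}=\exp[2\pi \mathrm{i}\,m l^2/\mu],$$ and let $S$ be the symmetric matrix which, in block form with respect to the four classes of primaries, is $$S=\frac1\nu\begin{pmatrix}A&1_{2\times n}&1_{2\times n\nu}&B'\\ 1_{n\times 2}&2_{n\times n}&D&0\\ 1_{n\nu\times 2}&D^t&E&0\\ B'^t&0&0&-\nu H\end{pmatrix},$$ where $k_{a\times b}$ is the $a\times b$ matrix all of whose entries are $k$, and, with $y=\nu/\sqrt\mu$, $$A=\frac12\begin{pmatrix}1-y&1+y\\1+y&1-y\end{pmatrix},\quad B'=y\begin{pmatrix}1&\cdots&1\\-1&\cdots&-1\end{pmatrix},\quad D_{i,(h,j)}=2\cos(2\pi ih/\nu),$$ $$E_{(h,j),(h',j')}=2\cos\bigl(2\pi(2\omega hh'+\nu hj'+\nu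 h'j)/\nu^2\bigr),\quad H_{l,l'}=\frac{2}{\sqrt\mu}\cos(2\pi ll'/\mu).$$ Then $(\Phi,0,S,T)$ is modular data. Moreover $S^2=I$, and its fusion coefficients $N_{x,y,z}$ are totally symmetric in the three indices and are as follows: $N_{0,x,y}=\delta_{x,y}$, and for $x,y,z\in\Phi\setminus\{0\}$ one has $N_{x,y,z}=1$ except in the following cases (and their reorderings), where $s,s'\in\{\pm1\}$ are arbitrary signs: - $N_{\mathfrak{b},\mathfrak{a}_i,\mathfrak{a}_i}=2$, $N_{\mathfrak{b},\mathfrak{c}_{h,i},\mathfrak{c}_{h,i}}=2$, $N_{\mathfrak{b},\mathfrak{d}_l,\mathfrak{d}_l}=0$; - $N_{\mathfrak{a}_i,\mathfrak{a}_j,\mathfrak{a}_k}=2$ if $k\equiv si+s'j \pmod\nu$ for some $s,s'$; - $N_{\mathfrak{c}_{h,i},\mathfrak{c}_{h',j},\mathfrak{c}_{h'',k}}=2$ if, for some $s,s'$, $h''\equiv sh+s'h'\pmod\nu$ and $k\equiv si+s'j+2\omega(sh+s'h'-h'')/\nu \pmod\nu$; - $N_{\mathfrak{a}_i,\mathfrak{c}_{h,j},\mathfrak{c}_{h,k}}=2$ if $si\equiv j-k\pmod\nu$ for some $s$; - $N_{\mathfrak{d}_l,\mathfrak{d}_{l'},\mathfrak{d}_{l''}}=0$ if $l''\equiv sl+s'l'\pmod\mu$ for some $s,s'$.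
   Context: Modular data $(\Phi,0,S,T)$ consists of a finite set $\Phi$, an element $0\in\Phi$, and complex matrices $S=(S_{i,j})_{i,j\in\Phi}$, $T=(T_{i,j})_{i,j\in\Phi}$ such that: (a) $S,T$ are unitary, $S$ is symmetric and $T$ is diagonal; (b) $S^2=(ST)^3$ and $S^4=I$; (c) $C:=S^2$ is a permutation matrix, and row $0$ of $S$ consists of nonzero real numbers; (d) for all $i,j,k\in\Phi$ the fusion coefficients $N_{i,j}^k:=\sum_{l\in\Phi}S_{i,l}S_{j,l}\overline{S_{k,l}}/S_{0,l}$ are nonnegative integers. One writes $N_{i,j,k}:=N_{i,j}^{Ck}$. *)

theory Defs
  imports "HOL-Analysis.Analysis" "HOL-Number_Theory.Cong" "HOL-Library.Multiset"
begin

section \<open>Matrices indexed by a finite set\<close>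

text \<open>
  The index set of modular data varies with a numerical parameter, so matrices are functions
  \<open>'a \<Rightarrow> 'a \<Rightarrow> complex\<close> accompanied by an explicit index set \<open>X\<close>; entries outside
  \<open>X \<times> X\<close> are irrelevant, and equality of matrices is equality on \<open>X \<times> X\<close>.
\<close>

definition mat_eq :: "'a set \<Rightarrow> ('a \<Rightarrow> 'a \<Rightarrow> complex) \<Rightarrow> ('a \<Rightarrow> 'a \<Rightarrow> complex) \<Rightarrow> bool" where
  "mat_eq X A B \<longleftrightarrow> (\<forall>i\<in>X. \<forall>j\<in>X. A i j = B i j)"

definition mat_id :: "'a \<Rightarrow> 'a \<Rightarrow> complex" where
  "mat_id i j = (if i = j then 1 else 0)"

definition mat_mult ::
  "'a set \<Rightarrow> ('a \<Rightarrow> 'a \<Rightarrow> complex) \<Rightarrow> ('a \<Rightarrow> 'a \<Rightarrow> complex) \<Rightarrow> 'a \<Rightarrow> 'a \<Rightarrow> complex" where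
  "mat_mult X A B i j = (\<Sum>k\<in>X. A i k * B k j)"

primrec mat_pow :: "'a set \<Rightarrow> ('a \<Rightarrow> 'a \<Rightarrow> complex) \<Rightarrow> nat \<Rightarrow> 'a \<Rightarrow> 'a \<Rightarrow> complex" where
  "mat_pow X A 0 = mat_id"
| "mat_pow X A (Suc k) = mat_mult X A (mat_pow X A k)"

definition mat_adjoint :: "('a \<Rightarrow> 'a \<Rightarrow> complex) \<Rightarrow> 'a \<Rightarrow> 'a \<Rightarrow> complex" where
  "mat_adjoint A i j = cnj (A j i)"

definition mat_unitary :: "'a set \<Rightarrow> ('a \<Rightarrow> 'a \<Rightarrow> complex) \<Rightarrow> bool" where
  "mat_unitary X A \<longleftrightarrow>
     mat_eq X (mat_mult X A (mat_adjoint A)) mat_id \<and>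
     mat_eq X (mat_mult X (mat_adjoint A) A) mat_id"

definition mat_symmetric :: "'a set \<Rightarrow> ('a \<Rightarrow> 'a \<Rightarrow> complex) \<Rightarrow> bool" where
  "mat_symmetric X A \<longleftrightarrow> (\<forall>i\<in>X. \<forall>j\<in>X. A i j = A j i)"

definition mat_diagonal :: "'a set \<Rightarrow> ('a \<Rightarrow> 'a \<Rightarrow> complex) \<Rightarrow> bool" where
  "mat_diagonal X A \<longleftrightarrow> (\<forall>i\<in>X. \<forall>j\<in>X. i \<noteq> j \<longrightarrow> A i j = 0)"

definition mat_permutation :: "'a set \<Rightarrow> ('a \<Rightarrow> 'a \<Rightarrow> complex) \<Rightarrow> bool" where
  "mat_permutation X A \<longleftrightarrow>
     (\<exists>\<pi>. bij_betw \<pi> X X \<and> (\<forall>i\<in>X. \<forall>j\<in>X. A i j = (if j = \<pi> i then 1 else 0)))"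


section \<open>Modular data\<close>

text \<open>\<open>fusion X z S i j k\<close> is $N_{i,j}^k$, where \<open>z\<close> is the distinguished element $0$.\<close>

definition fusion :: "'a set \<Rightarrow> 'a \<Rightarrow> ('a \<Rightarrow> 'a \<Rightarrow> complex) \<Rightarrow> 'a \<Rightarrow> 'a \<Rightarrow> 'a \<Rightarrow> complex" where
  "fusion X z S i j k = (\<Sum>l\<in>X. S i l * S j l * cnj (S k l) / S z l)"

definition modular_data ::
  "'a set \<Rightarrow> 'a \<Rightarrow> ('a \<Rightarrow> 'a \<Rightarrow> complex) \<Rightarrow> ('a \<Rightarrow> 'a \<Rightarrow> complex) \<Rightarrow> bool" where
  "modular_data X z S T \<longleftrightarrow>
     finite X \<and> z \<in> X \<and>
     mat_unitary X S \<and> mat_unitary X T \<and> mat_symmetric X S \<and> mat_diagonal X T \<and>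
     mat_eq X (mat_pow X S 2) (mat_pow X (mat_mult X S T) 3) \<and>
     mat_eq X (mat_pow X S 4) mat_id \<and>
     mat_permutation X (mat_pow X S 2) \<and>
     (\<forall>j\<in>X. S z j \<in> \<real> \<and> S z j \<noteq> 0) \<and>
     (\<forall>i\<in>X. \<forall>j\<in>X. \<forall>k\<in>X. fusion X z S i j k \<in> \<nat>)"

text \<open>
  The permutation of \<open>X\<close> given by the permutation matrix $C = S^2$, and the coefficients
  $N_{i,j,k} = N_{i,j}^{Ck}$.
\<close>

definition charge_conj :: "'a set \<Rightarrow> ('a \<Rightarrow> 'a \<Rightarrow> complex) \<Rightarrow> 'a \<Rightarrow> 'a" where
  "charge_conj X S k = (THE k'. k' \<in> X \<and> mat_pow X S 2 k k' = 1)"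

definition fusion3 :: "'a set \<Rightarrow> 'a \<Rightarrow> ('a \<Rightarrow> 'a \<Rightarrow> complex) \<Rightarrow> 'a \<Rightarrow> 'a \<Rightarrow> 'a \<Rightarrow> complex" where
  "fusion3 X z S i j k = fusion X z S i j (charge_conj X S k)"


section \<open>The matrices \<open>S\<close> and \<open>T\<close>\<close>

datatype primary = Prim_0 | Prim_b | Prim_a nat | Prim_c nat nat | Prim_d nat

definition nu :: "nat \<Rightarrow> nat" where
  "nu n = 2 * n + 1"

definition em :: "nat \<Rightarrow> nat" where
  "em n = 2 * (n\<^sup>2 + n + 1)"

definition mu :: "nat \<Rightarrow> nat" where
  "mu n = 2 * em n + 1"

lemma mu_eq_nu: "mu n = (nu n)\<^sup>2 + 4"
  by (simp add: mu_def nu_def em_def power2_eq_square algebra_simps)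

definition primaries :: "nat \<Rightarrow> primary set" where
  "primaries n =
     {Prim_0, Prim_b} \<union>
     {Prim_a i | i. 1 \<le> i \<and> i \<le> n} \<union>
     {Prim_c h j | h j. 1 \<le> h \<and> h \<le> n \<and> j < nu n} \<union>
     {Prim_d l | l. 1 \<le> l \<and> l \<le> em n}"

fun T_entry :: "nat \<Rightarrow> int \<Rightarrow> primary \<Rightarrow> complex" where
  "T_entry n \<omega> Prim_0 = 1"
| "T_entry n \<omega> Prim_b = 1"
| "T_entry n \<omega> (Prim_a i) = 1"
| "T_entry n \<omega> (Prim_c h j) =
     exp (2 * complex_of_real pi * \<i> *
       complex_of_real ((real_of_int \<omega> * (real h)\<^sup>2 + real (nu n) * real h * real j) / (real (nu n))\<^sup>2))"
| "T_entry n \<omega> (Prim_d l) =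
     exp (2 * complex_of_real pi * \<i> *
       complex_of_real (real (em n) * (real l)\<^sup>2 / real (mu n)))"

definition T_mat :: "nat \<Rightarrow> int \<Rightarrow> primary \<Rightarrow> primary \<Rightarrow> complex" where
  "T_mat n \<omega> p q = (if p = q then T_entry n \<omega> p else 0)"

definition yy :: "nat \<Rightarrow> real" where
  "yy n = real (nu n) / sqrt (real (mu n))"

definition D_block :: "nat \<Rightarrow> nat \<Rightarrow> nat \<Rightarrow> nat \<Rightarrow> real" where
  "D_block n i h j = 2 * cos (2 * pi * real i * real h / real (nu n))"

definition E_block :: "nat \<Rightarrow> int \<Rightarrow> nat \<Rightarrow> nat \<Rightarrow> nat \<Rightarrow> nat \<Rightarrow> real" where
  "E_block n \<omega> h j h' j' =
     2 * cos (2 * pi *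
       (2 * real_of_int \<omega> * real h * real h' + real (nu n) * real h * real j'
          + real (nu n) * real h' * real j) / (real (nu n))\<^sup>2)"

definition H_block :: "nat \<Rightarrow> nat \<Rightarrow> nat \<Rightarrow> real" where
  "H_block n l l' = 2 / sqrt (real (mu n)) * cos (2 * pi * real l * real l' / real (mu n))"

fun S_block :: "nat \<Rightarrow> int \<Rightarrow> primary \<Rightarrow> primary \<Rightarrow> real" where
  "S_block n \<omega> Prim_0 Prim_0 = (1 - yy n) / 2"
| "S_block n \<omega> Prim_0 Prim_b = (1 + yy n) / 2"
| "S_block n \<omega> Prim_0 (Prim_a i) = 1"
| "S_block n \<omega> Prim_0 (Prim_c h j) = 1"
| "S_block n \<omega> Prim_0 (Prim_d l) = yy n"

| "S_block n \<omega> Prim_b Prim_0 = (1 + yy n) / 2"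
| "S_block n \<omega> Prim_b Prim_b = (1 - yy n) / 2"
| "S_block n \<omega> Prim_b (Prim_a i) = 1"
| "S_block n \<omega> Prim_b (Prim_c h j) = 1"
| "S_block n \<omega> Prim_b (Prim_d l) = - yy n"

| "S_block n \<omega> (Prim_a i) Prim_0 = 1"
| "S_block n \<omega> (Prim_a i) Prim_b = 1"
| "S_block n \<omega> (Prim_a i) (Prim_a i') = 2"
| "S_block n \<omega> (Prim_a i) (Prim_c h j) = D_block n i h j"
| "S_block n \<omega> (Prim_a i) (Prim_d l) = 0"

| "S_block n \<omega> (Prim_c h j) Prim_0 = 1"
| "S_block n \<omega> (Prim_c h j) Prim_b = 1"
| "S_block n \<omega> (Prim_c h j) (Prim_a i) = D_block n i h j"
| "S_block n \<omega> (Prim_c h j) (Prim_c h' j') = E_block n \<omega> h j h' j'"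
| "S_block n \<omega> (Prim_c h j) (Prim_d l) = 0"

| "S_block n \<omega> (Prim_d l) Prim_0 = yy n"
| "S_block n \<omega> (Prim_d l) Prim_b = - yy n"
| "S_block n \<omega> (Prim_d l) (Prim_a i) = 0"
| "S_block n \<omega> (Prim_d l) (Prim_c h j) = 0"
| "S_block n \<omega> (Prim_d l) (Prim_d l') = - (real (nu n) * H_block n l l')"

definition S_mat :: "nat \<Rightarrow> int \<Rightarrow> primary \<Rightarrow> primary \<Rightarrow> complex" where
  "S_mat n \<omega> p q = complex_of_real (1 / real (nu n) * S_block n \<omega> p q)"


section \<open>The exceptional fusion coefficients\<close>

text \<open>
  The exceptional triples are given as multisets, so that all reorderings are included.
  They are only used for primaries in the index set, which bounds the indices.  In rule
  \<open>ccc\<close> the division by \<open>\<nu>\<close> is exact: the first congruence makes \<open>\<nu>\<close> divide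
  \<open>s * h + s' * h' - h''\<close>.
\<close>

inductive fusion_two :: "nat \<Rightarrow> int \<Rightarrow> primary multiset \<Rightarrow> bool" for n :: nat and \<omega> :: int where
  baa: "fusion_two n \<omega> {#Prim_b, Prim_a i, Prim_a i#}"
| bcc: "fusion_two n \<omega> {#Prim_b, Prim_c h i, Prim_c h i#}"
| aaa: "fusion_two n \<omega> {#Prim_a i, Prim_a j, Prim_a k#}"
    if "s \<in> {1, -1}" "s' \<in> {1, -1}"
       "[int k = s * int i + s' * int j] (mod int (nu n))"
| ccc: "fusion_two n \<omega> {#Prim_c h i, Prim_c h' j, Prim_c h'' k#}"
    if "s \<in> {1, -1}" "s' \<in> {1, -1}"
       "[int h'' = s * int h + s' * int h'] (mod int (nu n))"
       "[int k = s * int i + s' * int j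
           + (2 * \<omega> * (s * int h + s' * int h' - int h'')) div int (nu n)] (mod int (nu n))"
| acc: "fusion_two n \<omega> {#Prim_a i, Prim_c h j, Prim_c h k#}"
    if "s \<in> {1, -1}" "[s * int i = int j - int k] (mod int (nu n))"

inductive fusion_zero :: "nat \<Rightarrow> primary multiset \<Rightarrow> bool" for n :: nat where
  bdd: "fusion_zero n {#Prim_b, Prim_d l, Prim_d l#}"
| ddd: "fusion_zero n {#Prim_d l, Prim_d l', Prim_d l''#}"
    if "s \<in> {1, -1}" "s' \<in> {1, -1}"
       "[int l'' = s * int l + s' * int l'] (mod int (mu n))"

end

theory Submission
  imports Defs
begin

text \<open>
  Behind the matrices are two finite abelian groups of odd order with a nondegenerate quadratic form.
  The group \<open>K\<close> of order \<open>\<nu>\<^sup>2\<close> is the quotient of \<open>\<int> \<times> \<int>\<close> by the lattice spanned by \<open>(0, \<nu>)\<close> and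
  \<open>(\<nu>, - 2 * \<omega>)\<close>, with quadratic character \<open>(h, j) \<mapsto> e((\<omega> * h\<^sup>2 + \<nu> * h * j) / \<nu>\<^sup>2)\<close>, where \<open>e(x) = exp(2 * \<pi> * \<i> * x)\<close>.
  The group \<open>\<Gamma>\<close> of order \<open>\<mu> = \<nu>\<^sup>2 + 4\<close> is \<open>\<int> / \<mu>\<close> with quadratic character \<open>l \<mapsto> e(m * l\<^sup>2 / \<mu>)\<close>.
  The primaries \<open>\<aa>\<close> and \<open>\<cc>\<close> are the pairs \<open>\<plusminus> k\<close> of nonzero elements of \<open>K\<close>, the primaries \<open>\<dd>\<close> are the
  pairs of nonzero elements of \<open>\<Gamma>\<close>, and \<open>0\<close> and \<open>\<bb>\<close> share the two neutral elements: in the basis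
  \<open>0 + \<bb>\<close>, \<open>0 - \<bb>\<close> the matrix \<open>S\<close> is the direct sum of the Fourier matrix of \<open>K\<close> on even functions and of minus
  the Fourier matrix of \<open>\<Gamma>\<close> on even functions. Lemma \<open>S_glue\<close> expresses this as one formula for all
  entries, and \<open>sum_primaries_fold\<close> turns a sum over primaries into half a sum over \<open>K\<close> plus half a
  sum over \<open>\<Gamma>\<close>.
  
  All claims then become character sums. Orthogonality gives \<open>S\<^sup>2 = 1\<close> (\<open>S_squared\<close>). Completing the square
  in \<open>S T S\<close> produces the Gauss sums of the two quadratic characters; these are \<open>\<nu>\<close> for \<open>K\<close> and
  \<open>- sqrt \<mu>\<close> for \<open>\<Gamma>\<close>, and the minus sign there cancels the minus sign in front of the second Fourier
  matrix, so \<open>S T S = T\<inverse> S T\<inverse>\<close> (\<open>S_T_S\<close>), which is \<open>(S T)\<^sup>3 = S\<^sup>2\<close>. The modulus \<open>\<mu>\<close> need not be prime, so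
  the sign of its Gauss sum is read off from the product formula of Gauss, valid for every odd modulus (\<open>triangular_gauss_sum\<close>).
  
  In the Verlinde sum the two terms for \<open>0\<close> and \<open>\<bb>\<close> have the denominators \<open>(1/\<nu> \<mp> 1/sqrt \<mu>)/2\<close>. Because of
  \<open>1/\<nu>\<^sup>2 - 1/\<mu> = 4/(\<nu>\<^sup>2 * \<mu>)\<close>, they supply exactly the missing contributions of the neutral elements of
  \<open>K\<close> and \<open>\<Gamma>\<close>, plus \<open>1\<close> if none of the three labels is \<open>0\<close> (\<open>verlinde_algebra\<close>). Hence, for nonzero labels,
  the fusion coefficient is \<open>1\<close> plus the numbers of sign solutions of \<open>\<plusminus> x \<plusminus> y \<plusminus> z = 0\<close> in \<open>K\<close> and in \<open>\<Gamma>\<close>,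
  each multiplied by the weights of the three labels (\<open>verlinde\<close>); for three labels of type \<open>\<aa>\<close> or \<open>\<cc>\<close> this is
  plus the number in \<open>K\<close>, for three labels of type \<open>\<dd>\<close> minus the number in \<open>\<Gamma>\<close>. For nonzero elements of a group of
  odd order there is at most one such solution up to a global sign (\<open>nsol_le_1\<close>), so the values are \<open>0\<close>, \<open>1\<close>
  and \<open>2\<close>, and the exceptional triples of the theorem are the ones for which the weighted numbers do not add up to zero.
\<close>

section \<open>Additive characters and sums over residue systems\<close>

definition ee :: "real \<Rightarrow> complex" where
  "ee x = cis (2 * pi * x)"

lemma ee_0 [simp]: "ee 0 = 1"
  by (simp add: ee_def)

lemma ee_add: "ee (x + y) = ee x * ee y"
  by (simp add: ee_def cis_mult distrib_left)

lemma ee_of_int [simp]: "ee (of_int k) = 1"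
  using cis_multiple_2pi[of "of_int k"] by (simp add: ee_def)

lemma ee_1 [simp]: "ee 1 = 1"
  using ee_of_int[of 1] by simp

lemma cnj_ee: "cnj (ee x) = ee (- x)"
  by (simp add: ee_def cis_cnj)

lemma ee_mult_minus [simp]: "ee x * ee (- x) = 1"
  by (simp flip: ee_add)

lemma ee_minus: "ee (- x) = 1 / ee x"
  by (simp add: ee_def inverse_eq_divide flip: cis_inverse)

lemma ee_power: "ee x ^ k = ee (real k * x)"
  by (simp add: ee_def Complex.DeMoivre mult_ac)

lemma ee_plus_minus: "ee x + ee (- x) = complex_of_real (2 * cos (2 * pi * x))"
  by (simp add: ee_def complex_eq_iff)

lemma ee_exp: "exp (2 * complex_of_real pi * \<i> * complex_of_real x) = ee x"
  by (simp add: ee_def cis_conv_exp algebra_simps)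

lemma ee_cong:
  assumes "x - y = of_int k"
  shows "ee x = ee y"
  using ee_add[of y "of_int k"] assms by (simp add: algebra_simps)

lemma ee_eq_1_iff: "ee x = 1 \<longleftrightarrow> x \<in> \<int>"
proof
  assume "ee x = 1"
  then have "cos (2 * pi * x) = 1" by (simp add: ee_def complex_eq_iff)
  then obtain k :: int where "2 * pi * x = of_int k * 2 * pi"
    by (auto simp: cos_one_2pi_int)
  then have "x = of_int k" by simp
  then show "x \<in> \<int>" by simp
qed (auto elim: Ints_cases)

text \<open>
  The window of summation is left arbitrary because the primaries use \<open>{0..<\<nu>}\<close> for one coordinate,
  whereas evenness arguments need windows symmetric about \<open>0\<close>.
\<close>
lemma sum_residues_shift:
  fixes f :: "int \<Rightarrow> 'a::ab_group_add"
  assumes per: "\<And>x. f (x + int N) = f x"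
  shows "(\<Sum>x\<in>{a..<a + int N}. f (x + v)) = (\<Sum>x\<in>{0..<int N}. f x)"
proof -
  define W where "W c = (\<Sum>x\<in>{c..<c + int N}. f x)" for c
  have step: "W (c + 1) = W c" for c
  proof (cases "N = 0")
    case False
    have "{c..<c + int N + 1} = insert c {c + 1..<c + 1 + int N}"
         "{c..<c + int N + 1} = insert (c + int N) {c..<c + int N}"
      using False by auto
    then have "(\<Sum>x\<in>insert c {c + 1..<c + 1 + int N}. f x)
        = (\<Sum>x\<in>insert (c + int N) {c..<c + int N}. f x)"
      by argo
    then have "f c + W (c + 1) = f (c + int N) + W c"
      unfolding W_def by (subst (asm) (1 2) sum.insert) auto
    then show ?thesis by (simp add: per)
  qed (simp add: W_def)
  have up: "W (c + int k) = W c" for c k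
  proof (induction k)
    case (Suc k)
    show ?case using step[of "c + int k"] Suc by (simp add: algebra_simps)
  qed simp
  have "W c = W 0" for c
  proof (cases "c \<ge> 0")
    case True
    then show ?thesis using up[of 0 "nat c"] by simp
  next
    case False
    then show ?thesis using up[of c "nat (- c)"] by simp
  qed
  moreover have "(\<Sum>x\<in>{a..<a + int N}. f (x + v)) = W (a + v)"
    unfolding W_def
    by (rule sum.reindex_bij_witness[of _ "\<lambda>x. x - v" "\<lambda>x. x + v"]) auto
  ultimately show ?thesis by (simp add: W_def)
qed

lemma sum_residues_symmetric:
  fixes f :: "int \<Rightarrow> 'a::ab_group_add"
  assumes "\<And>x. f (x + int (2 * n + 1)) = f x"
  shows "(\<Sum>x\<in>{- int n..int n}. f (x + v)) = (\<Sum>x\<in>{0..<int (2 * n + 1)}. f x)"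
proof -
  have "{- int n..int n} = {- int n..<- int n + int (2 * n + 1)}" by auto
  then show ?thesis using sum_residues_shift[where f = f and N = "2 * n + 1" and a = "- int n" and v = v, OF assms] by (simp only:)
qed

lemma sum_characters:
  assumes "N > 0"
  shows "(\<Sum>x\<in>{0..<int N}. ee (of_int (k * x) / real N)) = (if int N dvd k then of_nat N else 0)"
proof (cases "int N dvd k")
  case True
  then obtain r where "k = int N * r" ..
  then have "of_int (k * x) / real N = of_int (r * x)" for x
    using assms by (simp add: field_simps)
  then have "ee (of_int (k * x) / real N) = 1" for x using ee_of_int by presburger
  then show ?thesis using True by simp
next
  case False
  let ?f = "\<lambda>x. ee (of_int (k * x) / real N)"
  let ?z = "ee (of_int k / real N)"
  have per: "?f (x + int N) = ?f x" for x
    by (rule ee_cong[where k = k]) (use assms in \<open>simp add: field_simps\<close>)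
  have "?f (x + 1) = ?f x * ?z" for x
    by (simp add: add_divide_distrib distrib_left flip: ee_add)
  then have "(\<Sum>x\<in>{0..<int N}. ?f x) * ?z = (\<Sum>x\<in>{0..<int N}. ?f (x + 1))"
    by (simp add: sum_distrib_right)
  also have "\<dots> = (\<Sum>x\<in>{0..<int N}. ?f x)"
    using sum_residues_shift[where f = ?f and a = 0 and v = 1, OF per] by (simp only: add_0)
  finally have eq: "(\<Sum>x\<in>{0..<int N}. ?f x) * (?z - 1) = 0" by (simp add: algebra_simps)
  have "?z \<noteq> 1"
  proof
    assume "?z = 1"
    then obtain r where "of_int k / real N = of_int r"
      unfolding ee_eq_1_iff by (auto elim: Ints_cases)
    then have "real_of_int k = of_int (int N * r)" using assms by (simp add: field_simps)
    then have "k = int N * r" by linarith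
    with False show False by simp
  qed
  with eq False show ?thesis by simp
qed

lemma sum_characters_symmetric:
  "(\<Sum>x\<in>{- int n..int n}. ee (of_int (k * (x + v)) / real (2 * n + 1)))
     = (if int (2 * n + 1) dvd k then of_nat (2 * n + 1) else 0)"
proof -
  have "ee (of_int (k * (x + int (2 * n + 1))) / real (2 * n + 1))
      = ee (of_int (k * x) / real (2 * n + 1))" for x
    by (rule ee_cong[where k = k]) (simp add: divide_simps, simp add: algebra_simps)
  from sum_residues_symmetric[of "\<lambda>x. ee (of_int (k * x) / real (2 * n + 1))" n v, OF this]
  show ?thesis using sum_characters[of "2 * n + 1" k] by simp
qed

lemma sum_symmetric_interval:
  fixes f :: "int \<Rightarrow> 'a::comm_monoid_add"
  shows "(\<Sum>x\<in>{- int n..int n}. f x) = f 0 + (\<Sum>i\<in>{1..n}. f (int i) + f (- int i))"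
proof (induction n)
  case (Suc n)
  have "{- int (Suc n)..int (Suc n)} = insert (int (Suc n)) (insert (- int (Suc n)) {- int n..int n})"
    by auto
  then have "(\<Sum>x\<in>{- int (Suc n)..int (Suc n)}. f x)
      = f (int (Suc n)) + (f (- int (Suc n)) + (\<Sum>x\<in>{- int n..int n}. f x))"
    by simp
  then show ?case by (simp add: Suc.IH add_ac)
qed simp


section \<open>The quadratic Gauss sum of odd modulus\<close>

text \<open>
  Gaussian binomial coefficient as a quotient of products. Truncated subtraction makes one factor
  vanish when \<open>k > m\<close>; the formula has its usual meaning only as long as \<open>q\<close> is no root of unity
  of order at most \<open>k\<close>.
\<close>
definition qbinom :: "complex \<Rightarrow> nat \<Rightarrow> nat \<Rightarrow> complex" where
  "qbinom q m k = (\<Prod>i<k. (1 - q ^ (m - i)) / (1 - q ^ Suc i))"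

lemma qbinom_0 [simp]: "qbinom q m 0 = 1"
  by (simp add: qbinom_def)

lemma qbinom_Suc: "qbinom q m (Suc k) = qbinom q m k * (1 - q ^ (m - k)) / (1 - q ^ Suc k)"
  by (simp add: qbinom_def)

lemma qbinom_eq_0: "m < k \<Longrightarrow> qbinom q m k = 0"
  unfolding qbinom_def by (rule prod_zero) (auto intro!: bexI[of _ m])

lemma qbinom_absorb:
  assumes "j \<le> Suc m"
  shows "qbinom q (Suc m) j * (1 - q ^ (Suc m - j)) = (1 - q ^ Suc m) * qbinom q m j"
  using assms
proof (induction j)
  case (Suc j)
  then have IH: "qbinom q (Suc m) j * (1 - q ^ (Suc m - j)) = (1 - q ^ Suc m) * qbinom q m j"
    by simp
  show ?case
    unfolding qbinom_Suc diff_Suc_Suc IH by simp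
qed simp

lemma qbinom_pascal:
  assumes "k \<le> m" "q ^ Suc k \<noteq> 1"
  shows "qbinom q (Suc m) (Suc k) = qbinom q m (Suc k) + q ^ (m - k) * qbinom q m k"
proof -
  have "q ^ Suc m = q ^ (m - k) * q ^ Suc k"
    using assms(1) by (simp flip: power_add)
  then have "qbinom q m k * (1 - q ^ Suc m)
      = qbinom q m k * (1 - q ^ (m - k)) + q ^ (m - k) * qbinom q m k * (1 - q ^ Suc k)"
    by (simp add: right_diff_distrib mult_ac del: power_Suc)
  moreover have "qbinom q (Suc m) (Suc k) = qbinom q m k * (1 - q ^ Suc m) / (1 - q ^ Suc k)"
    using qbinom_absorb[of k m q] assms(1) by (simp add: qbinom_Suc mult_ac)
  ultimately show ?thesis
    using assms(2) by (simp add: qbinom_Suc[of q m k] add_divide_distrib del: power_Suc)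
qed

text \<open>
  The Pascal rule telescopes the alternating sum to one with weights \<open>1 - q ^ (m + 1 - k)\<close>, and the
  absorption rule then lowers the upper index once more.
\<close>
lemma alternating_qbinom_step:
  assumes "\<And>i. 0 < i \<Longrightarrow> i \<le> m + 2 \<Longrightarrow> q ^ i \<noteq> 1"
  shows "(\<Sum>k\<le>m + 2. (-1) ^ k * qbinom q (m + 2) k)
       = (1 - q ^ (m + 1)) * (\<Sum>k\<le>m. (-1) ^ k * qbinom q m k)"
proof -
  have "(\<Sum>k\<le>m + 2. (-1) ^ k * qbinom q (m + 2) k)
      = 1 - (\<Sum>k\<le>m + 1. (-1) ^ k * qbinom q (m + 2) (Suc k))"
    by (simp add: sum.atMost_Suc_shift sum_negf del: sum.atMost_Suc)
  also have "(\<Sum>k\<le>m + 1. (-1) ^ k * qbinom q (m + 2) (Suc k))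
      = (\<Sum>k\<le>m + 1. (-1) ^ k * qbinom q (m + 1) (Suc k))
        + (\<Sum>k\<le>m + 1. (-1) ^ k * (q ^ (m + 1 - k) * qbinom q (m + 1) k))"
    unfolding sum.distrib[symmetric]
    by (rule sum.cong) (use assms in \<open>simp_all add: qbinom_pascal distrib_left del: power_Suc\<close>)
  also have "(\<Sum>k\<le>m + 1. (-1) ^ k * qbinom q (m + 1) (Suc k))
      = 1 - (\<Sum>k\<le>m + 2. (-1) ^ k * qbinom q (m + 1) k)"
    by (simp add: sum.atMost_Suc_shift sum_negf del: sum.atMost_Suc)
  also have "(\<Sum>k\<le>m + 2. (-1) ^ k * qbinom q (m + 1) k) = (\<Sum>k\<le>m + 1. (-1) ^ k * qbinom q (m + 1) k)"
    by (simp add: qbinom_eq_0)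
  finally have "(\<Sum>k\<le>m + 2. (-1) ^ k * qbinom q (m + 2) k)
      = (\<Sum>k\<le>m + 1. (-1) ^ k * (qbinom q (m + 1) k * (1 - q ^ (m + 1 - k))))"
    by (simp add: algebra_simps sum_subtractf del: sum.atMost_Suc)
  also have "\<dots> = (\<Sum>k\<le>m + 1. (-1) ^ k * ((1 - q ^ (m + 1)) * qbinom q m k))"
    by (rule sum.cong) (use qbinom_absorb[of _ m q] in auto)
  also have "\<dots> = (1 - q ^ (m + 1)) * (\<Sum>k\<le>m. (-1) ^ k * qbinom q m k)"
    by (simp add: qbinom_eq_0 sum_distrib_left algebra_simps)
  finally show ?thesis .
qed

lemma alternating_qbinom:
  assumes "\<And>i. 0 < i \<Longrightarrow> i \<le> 2 * m \<Longrightarrow> q ^ i \<noteq> 1"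
  shows "(\<Sum>k\<le>2 * m. (-1) ^ k * qbinom q (2 * m) k) = (\<Prod>j<m. 1 - q ^ (2 * j + 1))"
  using assms
proof (induction m)
  case (Suc m)
  have "(\<Sum>k\<le>2 * m + 2. (-1) ^ k * qbinom q (2 * m + 2) k)
      = (1 - q ^ (2 * m + 1)) * (\<Sum>k\<le>2 * m. (-1) ^ k * qbinom q (2 * m) k)"
    by (rule alternating_qbinom_step) (use Suc.prems in simp)
  also have "(\<Sum>k\<le>2 * m. (-1) ^ k * qbinom q (2 * m) k) = (\<Prod>j<m. 1 - q ^ (2 * j + 1))"
    by (rule Suc.IH) (use Suc.prems in simp)
  finally show ?case by (simp add: mult.commute del: sum.atMost_Suc)
qed simp

text \<open>
  Product formula of Gauss. For a primitive root of unity \<open>q\<close> of order \<open>N = 2 * m + 1\<close> one has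
  \<open>q ^ (2 * m - i) = 1 / q ^ (i + 1)\<close>, so every factor of the Gaussian binomial coefficient is
  \<open>- 1 / q ^ (i + 1)\<close> and the alternating sum becomes a sum over triangular numbers.
\<close>
lemma triangular_gauss_sum:
  fixes m :: nat
  defines "N \<equiv> 2 * m + 1"
  shows "(\<Sum>k\<le>2 * m. ee (- (real k * (real k + 1)) / (2 * real N)))
       = (\<Prod>j<m. 1 - ee (real (2 * j + 1) / real N))"
proof -
  let ?q = "ee (1 / real N)"
  have N: "real N > 0" by (simp add: N_def)
  have prim: "?q ^ i \<noteq> 1" if "0 < i" "i \<le> 2 * m" for i
  proof
    assume "?q ^ i = 1"
    then have "real i / real N \<in> \<int>" by (simp add: ee_power ee_eq_1_iff)
    then obtain r :: int where "real i / real N = of_int r" by (auto elim: Ints_cases)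
    then have "real_of_int (int i) = of_int (r * int N)" using N by (simp add: field_simps)
    then have "int i = r * int N" by linarith
    then have "int N dvd int i" by simp
    then have "N dvd i" by simp
    with that show False by (auto simp: N_def dest: dvd_imp_le)
  qed
  have summand: "(-1) ^ k * qbinom ?q (2 * m) k = ee (- (real k * (real k + 1)) / (2 * real N))"
    if "k \<le> 2 * m" for k
    using that
  proof (induction k)
    case (Suc k)
    let ?w = "?q ^ Suc k"
    have w: "?w \<noteq> 1" "?w \<noteq> 0" using prim[of "Suc k"] Suc.prems by (auto simp: ee_def)
    have "?q ^ (2 * m - k) * ?w = ?q ^ N"
      using Suc.prems by (simp add: N_def flip: power_add)
    also have "\<dots> = 1" using N by (simp add: ee_power)
    finally have "?q ^ (2 * m - k) = 1 / ?w" using w by (simp add: field_simps)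
    then have "(1 - ?q ^ (2 * m - k)) / (1 - ?w) = - (1 / ?w)"
      using w by (simp add: field_simps)
    also have "1 / ?w = ee (- ((real k + 1) / real N))"
      by (simp add: ee_minus ee_power add.commute del: power_Suc)
    finally have f: "(1 - ?q ^ (2 * m - k)) / (1 - ?w) = - ee (- ((real k + 1) / real N))" .
    have "(-1) ^ Suc k * qbinom ?q (2 * m) (Suc k)
        = - ((-1) ^ k * qbinom ?q (2 * m) k) * ((1 - ?q ^ (2 * m - k)) / (1 - ?w))"
      by (simp add: qbinom_Suc)
    also have "\<dots> = ee (- (real k * (real k + 1)) / (2 * real N)) * ee (- ((real k + 1) / real N))"
      using Suc.IH Suc.prems by (simp only: f) simp
    also have "\<dots> = ee (- (real (Suc k) * (real (Suc k) + 1)) / (2 * real N))"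
      unfolding ee_add[symmetric] using N by (intro arg_cong[where f = ee]) (simp add: field_simps)
    finally show ?case .
  qed simp
  have "(\<Sum>k\<le>2 * m. ee (- (real k * (real k + 1)) / (2 * real N)))
      = (\<Sum>k\<le>2 * m. (-1) ^ k * qbinom ?q (2 * m) k)"
    by (rule sum.cong) (simp_all add: summand)
  also have "\<dots> = (\<Prod>j<m. 1 - ?q ^ (2 * j + 1))"
    using prim by (rule alternating_qbinom)
  finally show ?thesis by (simp add: ee_power del: power_Suc)
qed

lemma one_minus_ee: "1 - ee x = - 2 * \<i> * sin (pi * x) * ee (x / 2)"
proof -
  have "cos (2 * pi * x) = 1 - 2 * sin (pi * x) ^ 2"
    using cos_double_sin[of "pi * x"] by (simp add: mult_ac)
  moreover have "sin (2 * pi * x) = 2 * sin (pi * x) * cos (pi * x)"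
    using sin_double[of "pi * x"] by (simp add: mult_ac)
  ultimately show ?thesis
    by (simp add: ee_def complex_eq_iff power2_eq_square mult_ac)
qed

text \<open>
  Shifting the summation variable by \<open>m + 1\<close>, an inverse of \<open>2\<close> modulo \<open>N\<close>, completes the square
  in the triangular sum. Each factor of the product is \<open>- 2 * \<i>\<close> times a positive sine times a phase;
  together with the phase from completing the square, these phases multiply up to \<open>1\<close>, and the sign is that of \<open>(- \<i>) ^ m\<close>.
\<close>
lemma gauss_sum_sign:
  fixes m :: nat
  assumes "even m"
  defines "N \<equiv> 2 * m + 1"
  obtains P :: real where "P > 0"
    "(\<Sum>l\<in>{- int m..int m}. ee (real m * (of_int l)\<^sup>2 / real N)) = (-1) ^ (m div 2) * of_real P"
proof
  have N: "real N > 0" by (simp add: N_def)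
  let ?t = "\<lambda>l::int. ee (real m * (of_int l)\<^sup>2 / real N)"
  let ?P = "2 ^ m * (\<Prod>j<m. sin (pi * (real (2 * j + 1) / real N)))"
  show "?P > 0"
    by (intro mult_pos_pos prod_pos ballI sin_gt_zero)
       (auto simp: N_def divide_simps)
  have per: "?t (l + int N) = ?t l" for l
    by (rule ee_cong[where k = "int m * (2 * l + int N)"])
       (use N in \<open>simp add: field_simps power2_eq_square\<close>)
  have "(\<Sum>l\<in>{- int m..int m}. ?t l) = (\<Sum>l\<in>{0..<int N}. ?t (l + int (m + 1)))"
    using sum_residues_symmetric[of ?t m 0, folded N_def, OF per]
      sum_residues_shift[where f = ?t and a = 0 and v = "int (m + 1)", OF per]
    by (simp only: add_0 add_0_right)
  also have "\<dots> = (\<Sum>k\<le>2 * m. ?t (int k + int (m + 1)))"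
    by (rule sum.reindex_bij_witness[of _ int nat]) (auto simp: N_def)
  also have "\<dots> = (\<Sum>k\<le>2 * m. ee (real m * (real m + 1)\<^sup>2 / real N)
                                * ee (- (real k * (real k + 1)) / (2 * real N)))"
  proof (rule sum.cong[OF refl])
    fix k :: nat
    have "even (k * (k + 1))" by simp
    then obtain r where "k * (k + 1) = 2 * r" by (elim evenE)
    then have r: "real k * (real k + 1) = 2 * real r"
      by (metis of_nat_1 of_nat_add of_nat_mult of_nat_numeral)
    show "?t (int k + int (m + 1)) = ee (real m * (real m + 1)\<^sup>2 / real N)
            * ee (- (real k * (real k + 1)) / (2 * real N))"
      unfolding ee_add[symmetric]
    proof (rule ee_cong[where k = "int (r + m * k)"])
      have "real m * (real k + (real m + 1))\<^sup>2 / real N - real m * (real m + 1)\<^sup>2 / real N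
          + real k * (real k + 1) / (2 * real N)
          = real k * (real k + 1) / 2 + real m * real k"
        using N by (simp add: field_simps power2_eq_square) (simp add: N_def algebra_simps)
      then show "real m * (of_int (int k + int (m + 1)))\<^sup>2 / real N -
          (real m * (real m + 1)\<^sup>2 / real N + - (real k * (real k + 1)) / (2 * real N))
          = of_int (int (r + m * k))"
        unfolding r by (simp add: add_ac)
    qed
  qed
  also have "\<dots> = ee (real m * (real m + 1)\<^sup>2 / real N) * (\<Prod>j<m. 1 - ee (real (2 * j + 1) / real N))"
    unfolding sum_distrib_left[symmetric] N_def using triangular_gauss_sum[of m] by simp
  also have "(\<Prod>j<m. 1 - ee (real (2 * j + 1) / real N))
      = (- \<i>) ^ m * of_real ?P * ee ((real m)\<^sup>2 / (2 * real N))"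
  proof -
    have "(\<Prod>j<k. ee (real (2 * j + 1) / real N / 2)) = ee ((real k)\<^sup>2 / (2 * real N))" for k
    proof (induction k)
      case (Suc k)
      then show ?case
        using N by (simp add: power2_eq_square field_simps flip: ee_add)
    qed simp
    note prod_ee = this
    have "(\<Prod>j<m. 1 - ee (real (2 * j + 1) / real N))
        = (\<Prod>j<m. - \<i> * 2 * (of_real (sin (pi * (real (2 * j + 1) / real N)))
                             * ee (real (2 * j + 1) / real N / 2)))"
      by (intro prod.cong refl) (simp only: one_minus_ee, simp)
    also have "\<dots> = (- \<i>) ^ m * 2 ^ m * ((\<Prod>j<m. of_real (sin (pi * (real (2 * j + 1) / real N))))
                             * ee ((real m)\<^sup>2 / (2 * real N)))"
      unfolding prod.distrib prod_constant card_lessThan prod_ee by (simp only: power_mult_distrib)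
    finally show ?thesis by (simp add: mult_ac)
  qed
  also have "ee (real m * (real m + 1)\<^sup>2 / real N) * ((- \<i>) ^ m * of_real ?P * ee ((real m)\<^sup>2 / (2 * real N)))
      = (- \<i>) ^ m * of_real ?P * ee (real m * (real m + 1)\<^sup>2 / real N + (real m)\<^sup>2 / (2 * real N))"
    by (simp add: ee_add)
  also have "real m * (real m + 1)\<^sup>2 / real N + (real m)\<^sup>2 / (2 * real N) = real m * (real m + 2) / 2"
    using N by (simp add: field_simps power2_eq_square) (simp add: N_def algebra_simps)
  also have "\<dots> = of_int (int (m div 2 * (m + 2)))"
    using assms(1) by (auto elim!: evenE simp: algebra_simps)
  also have "(- \<i>) ^ m = (-1) ^ (m div 2)"
    using assms(1) by (auto elim!: evenE simp: power_mult)
  finally show "(\<Sum>l\<in>{- int m..int m}. ?t l) = (-1) ^ (m div 2) * of_real ?P"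
    by (simp only: ee_of_int mult_1_right)
qed

section \<open>Even Fourier analysis on a metric group\<close>

text \<open>
  A finite quadratic group presented as a quotient: \<open>L\<close> is the subgroup divided out, \<open>R\<close> a set of
  representatives, \<open>b\<close> the bicharacter, \<open>t\<close> the quadratic character with polarization \<open>b\<close>, and \<open>G\<close> its Gauss sum.
  Working with representatives in a type-class group avoids carrying a quotient type that depends on \<open>n\<close>
  and \<open>\<omega>\<close>. That \<open>2\<close> is invertible on the quotient is assumption \<open>half_L\<close>.
\<close>
locale metric_group =
  fixes R L :: "'v::ab_group_add set"
    and b :: "'v \<Rightarrow> 'v \<Rightarrow> complex" and t :: "'v \<Rightarrow> complex" and G :: complex
  assumes fin: "finite R"
    and zero_L: "0 \<in> L" and add_L: "u \<in> L \<Longrightarrow> v \<in> L \<Longrightarrow> u + v \<in> L" and minus_L: "u \<in> L \<Longrightarrow> - u \<in> L"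
    and half_L: "u + u \<in> L \<Longrightarrow> u \<in> L"
    and zero_R: "0 \<in> R" and R_L: "u \<in> R \<Longrightarrow> u \<in> L \<Longrightarrow> u = 0"
    and b_sym: "b u v = b v u"
    and b_add: "b (u + v) w = b u w * b v w"
    and b_cnj: "cnj (b u v) = b (- u) v"
    and sum_b: "(\<Sum>x\<in>R. b v x) = (if v \<in> L then of_nat (card R) else 0)"
    and t_add: "t (u + v) = t u * t v * b u v"
    and t_minus: "t (- u) = t u"
    and t_unit: "t u * cnj (t u) = 1"
    and sum_t: "(\<Sum>x\<in>R. t (x + v)) = G"
begin

definition evenb :: "'v \<Rightarrow> 'v \<Rightarrow> complex" where
  "evenb u v = b u v + b (- u) v"

text \<open>
  The equation \<open>\<plusminus> u \<plusminus> v \<plusminus> w = 0\<close> has eight sign patterns; they are counted up to a global sign.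
\<close>
definition nsol :: "'v \<Rightarrow> 'v \<Rightarrow> 'v \<Rightarrow> nat" where
  "nsol u v w = of_bool (u + v + w \<in> L) + of_bool (u + v - w \<in> L)
     + of_bool (u - v + w \<in> L) + of_bool (- u + v + w \<in> L)"

lemma minus_L_iff: "- u \<in> L \<longleftrightarrow> u \<in> L"
  using minus_L[of u] minus_L[of "- u"] by auto

lemma b_zero: "b 0 v = 1"
proof -
  have "b 0 v = b 0 v * b 0 v" using b_add[of 0 0 v] by simp
  moreover have "b 0 v \<noteq> 0" using t_add[of 0 v] t_unit[of v] by auto
  ultimately show ?thesis by simp
qed

lemma b_diff: "b (u - v) w = b u w * b (- v) w"
  using b_add[of u "- v" w] by simp

lemma t_shift: "t (x + w) * cnj (t w) = t x * b x w"
proof -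
  have "t (x + w) * cnj (t w) = t x * b x w * (t w * cnj (t w))" by (simp add: t_add mult_ac)
  then show ?thesis by (simp add: t_unit)
qed

lemma b_minus2: "b u (- v) = b (- u) v"
  by (metis b_cnj b_sym)

lemma t_nonzero: "t u \<noteq> 0"
  using t_unit[of u] by auto

lemma t_zero: "t 0 = 1"
  using t_add[of 0 0] t_nonzero[of 0] by (simp add: b_zero)

lemma evenb_sym: "evenb u v = evenb v u"
  by (simp add: evenb_def b_sym[of u v] b_sym[of "- u" v] b_minus2)

lemma evenb_zero [simp]: "evenb 0 v = 2" "evenb v 0 = 2"
  by (simp_all add: evenb_def b_zero b_sym[of _ 0])

lemma evenb_minus [simp]: "evenb u (- v) = evenb u v" "evenb (- u) v = evenb u v"
  by (simp_all add: evenb_def b_minus2 add.commute)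

lemma sum_evenb3:
  "(\<Sum>x\<in>R. evenb u x * evenb v x * evenb w x) = 2 * of_nat (card R) * of_nat (nsol u v w)"
proof -
  let ?c = "of_nat (card R) :: complex"
  have "evenb u x * evenb v x * evenb w x =
      b (u + v + w) x + b (u + v - w) x + b (u - v + w) x + b (- u + v + w) x
      + (b (- (u + v + w)) x + b (- (u + v - w)) x + b (- (u - v + w)) x + b (- (- u + v + w)) x)" for x
    by (simp add: evenb_def b_add b_diff distrib_left distrib_right mult_ac add_ac)
  then show ?thesis
    by (simp only: sum.distrib sum_b minus_L_iff) (simp add: nsol_def distrib_left)
qed

lemma sum_evenb2:
  "(\<Sum>x\<in>R. evenb u x * evenb v x) = 2 * of_nat (card R) * (of_bool (u + v \<in> L) + of_bool (u - v \<in> L))"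
proof -
  have "- u + v \<in> L \<longleftrightarrow> u - v \<in> L" using minus_L_iff[of "u - v"] by simp
  then have "nsol u v 0 = 2 * (of_bool (u + v \<in> L) + of_bool (u - v \<in> L))"
    by (simp add: nsol_def)
  then show ?thesis using sum_evenb3[of u v 0] by (simp flip: sum_distrib_right)
qed

text \<open>
  Completing the square: \<open>t x * b v x\<close> is \<open>t (x + v)\<close> up to a factor independent of \<open>x\<close>, so that each
  of the four products of characters contributes the same Gauss sum.
\<close>
lemma sum_t_evenb2:
  "(\<Sum>x\<in>R. t x * evenb u x * evenb v x) = 2 * G * cnj (t u) * cnj (t v) * evenb u v"
proof -
  have one: "(\<Sum>x\<in>R. t x * b v x) = G * cnj (t v)" for v
  proof -
    have "t x * b v x = t (x + v) * cnj (t v)" for x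
      by (simp add: t_shift b_sym[of v x])
    then show ?thesis by (simp add: sum_t flip: sum_distrib_right)
  qed
  have cnj_t: "cnj (t (u + v)) = cnj (t u) * cnj (t v) * b (- u) v" for u v
    by (simp add: t_add b_cnj)
  have "t x * evenb u x * evenb v x
      = t x * b (u + v) x + t x * b (u + - v) x + t x * b (- u + v) x + t x * b (- u + - v) x" for x
    by (simp add: evenb_def b_add b_diff distrib_left distrib_right mult_ac add_ac)
  then show ?thesis
    by (simp only: sum.distrib one cnj_t t_minus b_minus2 minus_minus evenb_def)
       (simp add: algebra_simps)
qed

text \<open>
  Only the absolute value; with the sign found above, it determines the Gauss sum of \<open>\<Gamma>\<close>.
\<close>
lemma gauss_sum_norm: "G * cnj G = of_nat (card R)"
proof -
  have G: "G = (\<Sum>x\<in>R. t x)" using sum_t[of 0] by simp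
  have "G * cnj G = (\<Sum>w\<in>R. (\<Sum>x\<in>R. t (x + w)) * cnj (t w))"
    by (simp add: sum_t flip: sum_distrib_left) (simp add: G)
  also have "\<dots> = (\<Sum>w\<in>R. \<Sum>x\<in>R. t x * b x w)"
    by (simp add: sum_distrib_right t_shift)
  also have "\<dots> = (\<Sum>x\<in>R. \<Sum>w\<in>R. t x * b x w)" by (rule sum.swap)
  also have "\<dots> = (\<Sum>x\<in>R. if x = 0 then of_nat (card R) else 0)"
    by (intro sum.cong) (use R_L in \<open>auto simp: sum_b zero_L t_zero simp flip: sum_distrib_left\<close>)
  also have "\<dots> = of_nat (card R)" using fin zero_R by simp
  finally show ?thesis .
qed

lemma nsol_sym: "nsol u v w = nsol v u w" "nsol u v w = nsol u w v"
  by (simp_all add: nsol_def add_ac diff_conv_add_uminus del: add_uminus_conv_diff)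

lemma nsol_pos_iff:
  "nsol u v w \<noteq> 0 \<longleftrightarrow>
     u + v - w \<in> L \<or> u - v - w \<in> L \<or> - u + v - w \<in> L \<or> - u - v - w \<in> L"
proof -
  have "u - v - w \<in> L \<longleftrightarrow> - u + v + w \<in> L" "- u + v - w \<in> L \<longleftrightarrow> u - v + w \<in> L"
    "- u - v - w \<in> L \<longleftrightarrow> u + v + w \<in> L"
    using minus_L_iff[of "u - v - w"] minus_L_iff[of "- u + v - w"] minus_L_iff[of "- u - v - w"]
    by (simp_all add: algebra_simps)
  then show ?thesis by (auto simp: nsol_def)
qed

lemma nsol_zero:
  assumes "u + v \<notin> L" "u - v \<in> L"
  shows "nsol 0 u v = 2"
  using assms minus_L_iff[of "u - v"] by (simp add: nsol_def)

lemma nsol_zero_distinct: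
  assumes "u + v \<notin> L" "u - v \<notin> L"
  shows "nsol 0 u v = 0"
  using assms minus_L_iff[of "u - v"] by (simp add: nsol_def)

text \<open>
  Two different sign patterns have a sum or difference equal to twice one of \<open>u\<close>, \<open>v\<close>, \<open>w\<close>, which
  cannot be zero in a group of odd order.
\<close>
lemma nsol_le_1:
  assumes "u \<notin> L" "v \<notin> L" "w \<notin> L"
  shows "nsol u v w \<le> 1"
proof -
  have diff: "x - y \<in> L" if "x \<in> L" "y \<in> L" for x y
    using add_L[OF that(1) minus_L[OF that(2)]] by simp
  have ex: "\<not> (x \<in> L \<and> y \<in> L)" if "x - y = z + z \<or> x + y = z + z" "z \<notin> L" for x y z
    using that diff[of x y] add_L[of x y] half_L[of z] by auto
  have "\<not> (u + v + w \<in> L \<and> u + v - w \<in> L)" by (rule ex[of _ _ w]) (use assms in auto)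
  moreover have "\<not> (u + v + w \<in> L \<and> u - v + w \<in> L)" by (rule ex[of _ _ v]) (use assms in auto)
  moreover have "\<not> (u + v + w \<in> L \<and> - u + v + w \<in> L)" by (rule ex[of _ _ u]) (use assms in auto)
  moreover have "\<not> (u + v - w \<in> L \<and> u - v + w \<in> L)" by (rule ex[of _ _ u]) (use assms in auto)
  moreover have "\<not> (u + v - w \<in> L \<and> - u + v + w \<in> L)" by (rule ex[of _ _ v]) (use assms in auto)
  moreover have "\<not> (u - v + w \<in> L \<and> - u + v + w \<in> L)" by (rule ex[of _ _ w]) (use assms in auto)
  ultimately show ?thesis by (auto simp: nsol_def)
qed

end

section \<open>The two metric groups\<close>

definition boxK :: "nat \<Rightarrow> (int \<times> int) set" where
  "boxK n = {- int n..int n} \<times> {- int n..int n}"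

definition latticeK :: "nat \<Rightarrow> int \<Rightarrow> (int \<times> int) set" where
  "latticeK n \<omega> = {(int (nu n) * r, int (nu n) * s - 2 * \<omega> * r) | r s. True}"

definition pairingK :: "nat \<Rightarrow> int \<Rightarrow> int \<times> int \<Rightarrow> int \<times> int \<Rightarrow> complex" where
  "pairingK n \<omega> u v = ee (of_int (2 * \<omega> * fst u * fst v + int (nu n) * fst u * snd v
     + int (nu n) * fst v * snd u) / (real (nu n))\<^sup>2)"

definition quadK :: "nat \<Rightarrow> int \<Rightarrow> int \<times> int \<Rightarrow> complex" where
  "quadK n \<omega> u = ee (of_int (\<omega> * (fst u)\<^sup>2 + int (nu n) * fst u * snd u) / (real (nu n))\<^sup>2)"

lemma nu_pos [simp]: "real (nu n) > 0" "nu n > 0"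
  by (simp_all add: nu_def)

lemma nu_nonzero [simp]: "nu n \<noteq> 0"
  by (simp add: nu_def)

lemma odd_nu: "odd (int (nu n))"
  by (simp add: nu_def)

lemma quadK_split: "quadK n \<omega> (x, y) = ee (of_int (\<omega> * x\<^sup>2) / (real (nu n))\<^sup>2) * ee (of_int (x * y) / real (nu n))"
proof -
  have "of_int (\<omega> * x\<^sup>2 + int (nu n) * x * y) / (real (nu n))\<^sup>2
      = of_int (\<omega> * x\<^sup>2) / (real (nu n))\<^sup>2 + of_int (x * y) / real (nu n)"
    using nu_pos(1)[of n] by (simp add: field_simps power2_eq_square)
  then show ?thesis unfolding quadK_def fst_conv snd_conv by (simp only: ee_add)
qed

lemma latticeK_iff: "(int (nu n) * r, j) \<in> latticeK n \<omega> \<longleftrightarrow> int (nu n) dvd 2 * \<omega> * r + j"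
proof
  assume "(int (nu n) * r, j) \<in> latticeK n \<omega>"
  then obtain r' s where "int (nu n) * r = int (nu n) * r'" "j = int (nu n) * s - 2 * \<omega> * r'"
    unfolding latticeK_def by blast
  then have "2 * \<omega> * r + j = int (nu n) * s" by simp
  then show "int (nu n) dvd 2 * \<omega> * r + j" by simp
next
  assume "int (nu n) dvd 2 * \<omega> * r + j"
  then obtain s where "2 * \<omega> * r + j = int (nu n) * s" ..
  then have "j = int (nu n) * s - 2 * \<omega> * r" by simp
  then show "(int (nu n) * r, j) \<in> latticeK n \<omega>" unfolding latticeK_def by blast
qed

lemma card_boxK: "card (boxK n) = (nu n)\<^sup>2"
proof -
  have "card {- int n..int n} = nu n" unfolding nu_def card_atLeastAtMost_int by arith
  then show ?thesis by (simp add: boxK_def card_cartesian_product power2_eq_square)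
qed

lemma sum_pairingK: "(\<Sum>x\<in>boxK n. pairingK n \<omega> v x) = (if v \<in> latticeK n \<omega> then of_nat (card (boxK n)) else 0)"
proof -
  obtain h j where v: "v = (h, j)" by (cases v)
  let ?\<nu> = "real (nu n)" and ?W = "{- int n..int n}"
  have nu: "?\<nu> > 0" by simp
  have split: "pairingK n \<omega> (h, j) (x, y)
      = ee (of_int ((2 * \<omega> * h + int (nu n) * j) * x) / ?\<nu>\<^sup>2) * ee (of_int (h * y) / ?\<nu>)" for x y
    unfolding pairingK_def ee_add[symmetric] fst_conv snd_conv
    using nu by (intro arg_cong[where f = ee]) (simp add: field_simps power2_eq_square)
  have inner: "(\<Sum>y\<in>?W. ee (of_int (h * y) / ?\<nu>)) = (if int (nu n) dvd h then of_nat (nu n) else 0)"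
    using sum_characters_symmetric[of h 0 n] by (simp add: nu_def)
  have "(\<Sum>x\<in>boxK n. pairingK n \<omega> v x)
      = (\<Sum>x\<in>?W. ee (of_int ((2 * \<omega> * h + int (nu n) * j) * x) / ?\<nu>\<^sup>2)
                 * (if int (nu n) dvd h then of_nat (nu n) else 0))"
    unfolding boxK_def sum.cartesian_product' v split inner[symmetric] sum_distrib_left ..
  also have "\<dots> = (if v \<in> latticeK n \<omega> then of_nat (card (boxK n)) else 0)"
  proof (cases "int (nu n) dvd h")
    case True
    then obtain r where h: "h = int (nu n) * r" ..
    have "of_int ((2 * \<omega> * h + int (nu n) * j) * x) / ?\<nu>\<^sup>2 = of_int ((2 * \<omega> * r + j) * x) / ?\<nu>" for x
      using nu by (simp add: h field_simps power2_eq_square)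
    then have "(\<Sum>x\<in>?W. ee (of_int ((2 * \<omega> * h + int (nu n) * j) * x) / ?\<nu>\<^sup>2))
        = (if int (nu n) dvd 2 * \<omega> * r + j then of_nat (nu n) else 0)"
      using sum_characters_symmetric[of "2 * \<omega> * r + j" 0 n] by (simp add: nu_def)
    moreover have "v \<in> latticeK n \<omega> \<longleftrightarrow> int (nu n) dvd 2 * \<omega> * r + j"
      unfolding v h by (rule latticeK_iff)
    moreover have "card (boxK n) = nu n * nu n" by (simp add: card_boxK power2_eq_square)
    ultimately show ?thesis using True by (simp flip: sum_distrib_right)
  next
    case False
    then have "v \<notin> latticeK n \<omega>" by (auto simp: latticeK_def v)
    then show ?thesis using False by simp
  qed
  finally show ?thesis .
qed

text \<open>
  The sum over the second coordinate keeps only first coordinates divisible by \<open>\<nu>\<close>. A symmetric window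
  of length \<open>\<nu>\<close> contains one of these, and there the remaining factor is \<open>1\<close>.
\<close>
lemma sum_quadK: "(\<Sum>x\<in>boxK n. quadK n \<omega> (x + v)) = of_nat (nu n)"
proof -
  obtain a c where v: "v = (a, c)" by (cases v)
  let ?\<nu> = "real (nu n)" and ?W = "{- int n..int n}"
  have inner: "(\<Sum>y\<in>?W. ee (of_int (h * (y + c)) / ?\<nu>)) = (if int (nu n) dvd h then of_nat (nu n) else 0)" for h
    using sum_characters_symmetric[of h c n] by (simp add: nu_def)
  have lattice: "ee (of_int (\<omega> * x\<^sup>2) / ?\<nu>\<^sup>2) = 1" if "int (nu n) dvd x" for x
  proof -
    from that obtain r where "x = int (nu n) * r" ..
    then have "of_int (\<omega> * x\<^sup>2) / ?\<nu>\<^sup>2 = of_int (\<omega> * r\<^sup>2)"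
      by (simp add: power_mult_distrib field_simps)
    then show ?thesis by (simp only: ee_of_int)
  qed
  have "(\<Sum>x\<in>boxK n. quadK n \<omega> (x + v))
      = (\<Sum>x\<in>?W. ee (of_int (\<omega> * (x + a)\<^sup>2) / ?\<nu>\<^sup>2)
                 * (if int (nu n) dvd x + a then of_nat (nu n) else 0))"
    unfolding boxK_def sum.cartesian_product' v add_Pair quadK_split inner[symmetric] sum_distrib_left ..
  also have "\<dots> = (\<Sum>x\<in>?W. if int (nu n) dvd x + a then of_nat (nu n) else 0)"
  proof (intro sum.cong refl)
    fix x
    show "ee (of_int (\<omega> * (x + a)\<^sup>2) / ?\<nu>\<^sup>2) * (if int (nu n) dvd x + a then of_nat (nu n) else 0)
        = (if int (nu n) dvd x + a then of_nat (nu n) else 0)"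
      using lattice[of "x + a"]
      by (cases "int (nu n) dvd x + a") (simp_all only: if_True if_False mult_1_left mult_zero_right)
  qed
  also have "\<dots> = (\<Sum>x\<in>{0..<int (nu n)}. if int (nu n) dvd x then of_nat (nu n) else 0)"
    unfolding nu_def by (rule sum_residues_symmetric) simp
  also have "\<dots> = (\<Sum>x\<in>{0..<int (nu n)}. if x = 0 then of_nat (nu n) else 0)"
    by (intro sum.cong) (auto dest: zdvd_imp_le)
  also have "\<dots> = of_nat (nu n)" by simp
  finally show ?thesis .
qed

lemma metric_group_K: "metric_group (boxK n) (latticeK n \<omega>) (pairingK n \<omega>) (quadK n \<omega>) (of_nat (nu n))"
proof
  fix u v w :: "int \<times> int"
  show "finite (boxK n)" "0 \<in> boxK n" by (simp_all add: boxK_def zero_prod_def)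
  show "0 \<in> latticeK n \<omega>"
    unfolding latticeK_def zero_prod_def by (rule CollectI, intro exI[of _ 0]) simp
  show "u + v \<in> latticeK n \<omega>" if "u \<in> latticeK n \<omega>" "v \<in> latticeK n \<omega>"
  proof -
    from that obtain r s r' s' where "u = (int (nu n) * r, int (nu n) * s - 2 * \<omega> * r)"
      "v = (int (nu n) * r', int (nu n) * s' - 2 * \<omega> * r')" by (auto simp: latticeK_def)
    then show ?thesis unfolding latticeK_def
      by (intro CollectI exI[of _ "r + r'"] exI[of _ "s + s'"]) (simp add: algebra_simps)
  qed
  show "- u \<in> latticeK n \<omega>" if "u \<in> latticeK n \<omega>"
  proof -
    from that obtain r s where "u = (int (nu n) * r, int (nu n) * s - 2 * \<omega> * r)"
      by (auto simp: latticeK_def)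
    then show ?thesis unfolding latticeK_def
      by (intro CollectI exI[of _ "- r"] exI[of _ "- s"]) (simp add: algebra_simps)
  qed
  show "u \<in> latticeK n \<omega>" if uu: "u + u \<in> latticeK n \<omega>"
  proof -
    obtain h j where u: "u = (h, j)" by (cases u)
    from uu obtain r s where hr: "h + h = int (nu n) * r" "j + j = int (nu n) * s - 2 * \<omega> * r"
      by (auto simp: latticeK_def u)
    have "int (nu n) * r = 2 * h" "int (nu n) * s = 2 * (j + \<omega> * r)" using hr by simp_all
    then have "even (int (nu n) * r)" "even (int (nu n) * s)" by (simp_all only: dvd_triv_left)
    then have "even r" "even s" using odd_nu[of n] by auto
    then obtain r' s' where "r = 2 * r'" "s = 2 * s'" by (elim evenE)
    with hr have "h = int (nu n) * r'" "j = int (nu n) * s' - 2 * \<omega> * r'" by simp_all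
    then show ?thesis by (auto simp: latticeK_def u)
  qed
  show "u = 0" if "u \<in> boxK n" "u \<in> latticeK n \<omega>"
  proof -
    from that(2) obtain r s where u: "u = (int (nu n) * r, int (nu n) * s - 2 * \<omega> * r)"
      by (auto simp: latticeK_def)
    have small: "x = 0" if "\<bar>int (nu n) * x\<bar> \<le> int n" for x
    proof (rule ccontr)
      assume "x \<noteq> 0"
      then have "int (nu n) * 1 \<le> int (nu n) * \<bar>x\<bar>" by (intro mult_left_mono) auto
      then have "int (nu n) \<le> int n"
        using that unfolding abs_mult abs_of_nat mult_1_right by (rule order_trans)
      then show False by (simp add: nu_def)
    qed
    from that(1) u have "r = 0" by (intro small) (auto simp: boxK_def abs_le_iff)
    moreover from this that(1) u have "s = 0" by (intro small) (auto simp: boxK_def abs_le_iff)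
    ultimately show ?thesis using u by (simp add: zero_prod_def)
  qed
  show "pairingK n \<omega> u v = pairingK n \<omega> v u" by (simp add: pairingK_def algebra_simps)
  show "pairingK n \<omega> (u + v) w = pairingK n \<omega> u w * pairingK n \<omega> v w"
    unfolding pairingK_def ee_add[symmetric] add_divide_distrib[symmetric] of_int_add[symmetric]
    by (simp add: algebra_simps)
  show "cnj (pairingK n \<omega> u v) = pairingK n \<omega> (- u) v"
    unfolding pairingK_def cnj_ee minus_divide_left
    by (intro arg_cong[where f = ee]) (simp add: algebra_simps)
  show "(\<Sum>x\<in>boxK n. pairingK n \<omega> v x) = (if v \<in> latticeK n \<omega> then of_nat (card (boxK n)) else 0)"
    by (rule sum_pairingK)
  show "quadK n \<omega> (u + v) = quadK n \<omega> u * quadK n \<omega> v * pairingK n \<omega> u v"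
    unfolding quadK_def pairingK_def ee_add[symmetric] add_divide_distrib[symmetric] of_int_add[symmetric]
    by (simp add: algebra_simps power2_eq_square)
  show "quadK n \<omega> (- u) = quadK n \<omega> u" by (simp add: quadK_def)
  show "quadK n \<omega> u * cnj (quadK n \<omega> u) = 1" by (simp add: quadK_def cnj_ee)
  show "(\<Sum>x\<in>boxK n. quadK n \<omega> (x + v)) = of_nat (nu n)" by (rule sum_quadK)
qed

definition boxG :: "nat \<Rightarrow> int set" where
  "boxG n = {- int (em n)..int (em n)}"

definition latticeG :: "nat \<Rightarrow> int set" where
  "latticeG n = {l. int (mu n) dvd l}"

definition pairingG :: "nat \<Rightarrow> int \<Rightarrow> int \<Rightarrow> complex" where
  "pairingG n u v = ee (of_int (- (u * v)) / real (mu n))"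

definition quadG :: "nat \<Rightarrow> int \<Rightarrow> complex" where
  "quadG n u = ee (real (em n) * (of_int u)\<^sup>2 / real (mu n))"

lemma mu_pos [simp]: "real (mu n) > 0" "mu n > 0"
  by (simp_all add: mu_def)

lemma card_boxG: "card (boxG n) = mu n"
  by (simp add: boxG_def mu_def nat_eq_iff)

lemma quadG_periodic: "quadG n (u + int (mu n)) = quadG n u"
  unfolding quadG_def
  by (rule ee_cong[where k = "int (em n) * (2 * u + int (mu n))"])
     (use mu_pos(1)[of n] in \<open>simp add: field_simps power2_eq_square\<close>)

text \<open>
  The Gauss sum is at first left unevaluated, since its absolute value is itself a consequence of the
  metric group structure.
\<close>
lemma metric_group_G_unevaluated: "metric_group (boxG n) (latticeG n) (pairingG n) (quadG n) (\<Sum>l\<in>boxG n. quadG n l)"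
proof
  fix u v w :: int
  show "finite (boxG n)" "0 \<in> boxG n" "0 \<in> latticeG n" by (simp_all add: boxG_def latticeG_def)
  show "u + v \<in> latticeG n" if "u \<in> latticeG n" "v \<in> latticeG n" using that by (simp add: latticeG_def)
  show "- u \<in> latticeG n" if "u \<in> latticeG n" using that by (simp add: latticeG_def)
  show "u \<in> latticeG n" if uu: "u + u \<in> latticeG n"
  proof -
    have "odd (int (mu n))" by (simp add: mu_def)
    then have "coprime (int (mu n)) 2" by simp
    moreover have "int (mu n) dvd 2 * u" using uu by (simp only: latticeG_def mult_2 mem_Collect_eq)
    ultimately show ?thesis by (simp add: latticeG_def coprime_dvd_mult_right_iff)
  qed
  show "u = 0" if "u \<in> boxG n" "u \<in> latticeG n"
    using that dvd_imp_le_int[of u "int (mu n)"] by (force simp: boxG_def latticeG_def mu_def)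
  show "pairingG n u v = pairingG n v u" by (simp add: pairingG_def mult.commute)
  show "pairingG n (u + v) w = pairingG n u w * pairingG n v w"
    unfolding pairingG_def ee_add[symmetric] add_divide_distrib[symmetric] of_int_add[symmetric]
    by (simp add: algebra_simps)
  show "cnj (pairingG n u v) = pairingG n (- u) v" by (simp add: pairingG_def cnj_ee)
  show "(\<Sum>x\<in>boxG n. pairingG n v x) = (if v \<in> latticeG n then of_nat (card (boxG n)) else 0)"
    using sum_characters_symmetric[of "- v" 0 "em n"] unfolding card_boxG
    by (simp add: boxG_def latticeG_def pairingG_def mu_def)
  show "quadG n (u + v) = quadG n u * quadG n v * pairingG n u v"
    unfolding quadG_def pairingG_def ee_add[symmetric] add_divide_distrib[symmetric]
  proof (rule ee_cong[where k = "u * v"], unfold diff_divide_distrib[symmetric], subst nonzero_divide_eq_eq)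
    have "real (mu n) = 2 * real (em n) + 1" by (simp add: mu_def)
    then show "real (em n) * (real_of_int (u + v))\<^sup>2 -
        (real (em n) * (real_of_int u)\<^sup>2 + real (em n) * (real_of_int v)\<^sup>2 + real_of_int (- (u * v)))
        = real_of_int (u * v) * real (mu n)"
      by (simp add: power2_eq_square algebra_simps)
  qed simp
  show "quadG n (- u) = quadG n u" by (simp add: quadG_def)
  show "quadG n u * cnj (quadG n u) = 1" by (simp add: quadG_def cnj_ee)
  have per: "quadG n (x + int (2 * em n + 1)) = quadG n x" for x
    using quadG_periodic[of n x] by (simp only: mu_def)
  show "(\<Sum>x\<in>boxG n. quadG n (x + v)) = (\<Sum>l\<in>boxG n. quadG n l)"
    unfolding boxG_def
    using sum_residues_symmetric[where f = "quadG n" and v = v, OF per]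
      sum_residues_symmetric[where f = "quadG n" and v = 0, OF per]
    by (simp only: add_0_right)
qed

text \<open>
  Here \<open>m div 2 = n\<^sup>2 + n + 1\<close> is odd, which is where the negative sign comes from.
\<close>
lemma sum_quadG: "(\<Sum>l\<in>boxG n. quadG n l) = - of_real (sqrt (real (mu n)))"
proof -
  have "even (em n)" by (simp add: em_def)
  then obtain P where P: "P > 0" and sum: "(\<Sum>l\<in>boxG n. quadG n l) = (-1) ^ (em n div 2) * of_real P"
    using gauss_sum_sign[of "em n"] unfolding boxG_def quadG_def mu_def by metis
  have "odd (em n div 2)" by (simp add: em_def)
  then have G: "(\<Sum>l\<in>boxG n. quadG n l) = - of_real P" using sum by simp
  from metric_group.gauss_sum_norm[OF metric_group_G_unevaluated[of n]]
  have "complex_of_real (P * P) = of_real (real (mu n))"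
    unfolding G card_boxG by simp
  then have "P * P = real (mu n)" unfolding of_real_eq_iff .
  then have "P = sqrt (real (mu n))" using P by (metis abs_of_pos real_sqrt_abs2)
  then show ?thesis using G by simp
qed

lemma metric_group_G:
  "metric_group (boxG n) (latticeG n) (pairingG n) (quadG n) (- of_real (sqrt (real (mu n))))"
  using metric_group_G_unevaluated[of n] by (simp only: sum_quadG)

interpretation K: metric_group "boxK n" "latticeK n \<omega>" "pairingK n \<omega>" "quadK n \<omega>" "of_nat (nu n)" for n \<omega>
  by (rule metric_group_K)

interpretation \<Gamma>: metric_group "boxG n" "latticeG n" "pairingG n" "quadG n" "- of_real (sqrt (real (mu n)))" for n
  by (rule metric_group_G)

section \<open>Gluing the two even Fourier matrices\<close>

text \<open>
  Weights of a primary in the two even Fourier matrices. The neutral elements are their own negatives, so their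
  orbits count half, and they are shared by \<open>0\<close> and \<open>\<bb>\<close> with opposite relative sign. The sign chosen for
  \<open>\<dd>\<close> makes row \<open>0\<close> of \<open>S\<close> positive there.
\<close>
fun wtK :: "primary \<Rightarrow> complex" where
  "wtK Prim_0 = 1 / 2"
| "wtK Prim_b = 1 / 2"
| "wtK (Prim_a i) = 1"
| "wtK (Prim_c h j) = 1"
| "wtK (Prim_d l) = 0"

fun wtG :: "primary \<Rightarrow> complex" where
  "wtG Prim_0 = 1 / 2"
| "wtG Prim_b = - 1 / 2"
| "wtG (Prim_a i) = 0"
| "wtG (Prim_c h j) = 0"
| "wtG (Prim_d l) = - 1"

fun pointK :: "primary \<Rightarrow> int \<times> int" where
  "pointK (Prim_a i) = (0, int i)"
| "pointK (Prim_c h j) = (int h, int j)"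
| "pointK _ = 0"

fun pointG :: "primary \<Rightarrow> int" where
  "pointG (Prim_d l) = int l"
| "pointG _ = 0"

definition normK :: "nat \<Rightarrow> complex" where
  "normK n = of_real (1 / real (nu n))"

definition normG :: "nat \<Rightarrow> complex" where
  "normG n = of_real (1 / sqrt (real (mu n)))"

lemma evenK_aa: "K.evenb n \<omega> (0, x) (0, y) = 2"
  by (simp add: K.evenb_def pairingK_def)

lemma evenK_ac: "K.evenb n \<omega> (0, int i) (int h, int j) = of_real (D_block n i h j)"
proof -
  have "of_int (int (nu n) * int h * int i) / (real (nu n))\<^sup>2 = real i * real h / real (nu n)"
    by (simp add: field_simps power2_eq_square)
  moreover have "K.evenb n \<omega> (0, int i) (int h, int j)
      = of_real (2 * cos (2 * pi * (of_int (int (nu n) * int h * int i) / (real (nu n))\<^sup>2)))"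
    unfolding ee_plus_minus[symmetric] by (simp add: K.evenb_def pairingK_def)
  ultimately show ?thesis by (simp add: D_block_def mult_ac)
qed

lemma evenK_cc: "K.evenb n \<omega> (int h, int j) (int h', int j') = of_real (E_block n \<omega> h j h' j')"
proof -
  let ?x = "of_int (2 * \<omega> * int h * int h' + int (nu n) * int h * int j'
     + int (nu n) * int h' * int j) / (real (nu n))\<^sup>2"
  have "of_int (2 * \<omega> * (- int h) * int h' + int (nu n) * (- int h) * int j'
     + int (nu n) * int h' * (- int j)) / (real (nu n))\<^sup>2 = - ?x"
    unfolding minus_divide_left by simp
  then have "K.evenb n \<omega> (int h, int j) (int h', int j') = of_real (2 * cos (2 * pi * ?x))"
    unfolding ee_plus_minus[symmetric] K.evenb_def pairingK_def by simp
  then show ?thesis by (simp add: E_block_def)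
qed

lemma evenG_dd: "\<Gamma>.evenb n (int l) (int l') = of_real (2 * cos (2 * pi * real l * real l' / real (mu n)))"
proof -
  have "\<Gamma>.evenb n (int l) (int l') = of_real (2 * cos (2 * pi * (real l * real l' / real (mu n))))"
    unfolding ee_plus_minus[symmetric] by (simp add: \<Gamma>.evenb_def pairingG_def)
  then show ?thesis by (simp add: mult_ac)
qed

text \<open>
  The two Fourier matrices enter with opposite signs, which compensates for the opposite signs of the
  Gauss sums.
\<close>
lemma S_glue:
  "S_mat n \<omega> p q = normK n * wtK p * wtK q * K.evenb n \<omega> (pointK p) (pointK q) - normG n * wtG p * wtG q * \<Gamma>.evenb n (pointG p) (pointG q)"
proof -
  have sym: "K.evenb n \<omega> (int h, int j) (0, int i) = of_real (D_block n i h j)" for h j i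
    using evenK_ac K.evenb_sym by metis
  have s: "sqrt (real (mu n)) > 0" by simp
  show ?thesis
    by (cases p; cases q; use s in \<open>simp add: S_mat_def normK_def normG_def evenK_aa evenK_ac evenK_cc evenG_dd sym yy_def H_block_def
      del: mu_pos\<close>;
        (simp add: field_simps)?)
qed

lemma evenK_periodic: "K.evenb n \<omega> u (h, j + int (nu n)) = K.evenb n \<omega> u (h, j)"
proof -
  have "pairingK n \<omega> u (h, j + int (nu n)) = pairingK n \<omega> u (h, j)" for u
    unfolding pairingK_def fst_conv snd_conv
    by (rule ee_cong[where k = "fst u"])
       (simp add: algebra_simps power2_eq_square flip: diff_divide_distrib)
  then show ?thesis by (simp add: K.evenb_def)
qed

lemma quadK_periodic: "quadK n \<omega> (h, j + int (nu n)) = quadK n \<omega> (h, j)"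
  unfolding quadK_def fst_conv snd_conv
  by (rule ee_cong[where k = h]) (simp add: algebra_simps power2_eq_square flip: diff_divide_distrib)

lemma primaries_image:
  "primaries n = {Prim_0, Prim_b} \<union> Prim_a ` {1..n}
     \<union> (\<lambda>(h, j). Prim_c h j) ` ({1..n} \<times> {..<nu n}) \<union> Prim_d ` {1..em n}"
  by (auto simp: primaries_def)

lemma finite_primaries: "finite (primaries n)"
  by (simp add: primaries_image)

lemma sum_primaries:
  "(\<Sum>l\<in>primaries n. F l) = F Prim_0 + F Prim_b + (\<Sum>i\<in>{1..n}. F (Prim_a i))
     + (\<Sum>h\<in>{1..n}. \<Sum>j\<in>{..<nu n}. F (Prim_c h j)) + (\<Sum>l\<in>{1..em n}. F (Prim_d l))"
  for F :: "primary \<Rightarrow> complex"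
proof -
  let ?A = "Prim_a ` {1..n}" and ?C = "(\<lambda>(h, j). Prim_c h j) ` ({1..n} \<times> {..<nu n})"
    and ?D = "Prim_d ` {1..em n}"
  have "sum F (primaries n) = sum F {Prim_0, Prim_b} + sum F ?A + sum F ?C + sum F ?D"
    unfolding primaries_image by ((subst sum.union_disjoint, simp, simp, force)+, rule refl)
  also have "sum F ?A = (\<Sum>i\<in>{1..n}. F (Prim_a i))"
    by (subst sum.reindex) (auto simp: inj_on_def)
  also have "sum F ?D = (\<Sum>l\<in>{1..em n}. F (Prim_d l))"
    by (subst sum.reindex) (auto simp: inj_on_def)
  also have "sum F ?C = (\<Sum>h\<in>{1..n}. \<Sum>j\<in>{..<nu n}. F (Prim_c h j))"
    by (subst sum.reindex) (auto simp: inj_on_def sum.cartesian_product intro!: sum.cong)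
  finally show ?thesis by simp
qed

text \<open>
  The primaries of type \<open>\<aa>\<close> form half of the row \<open>h = 0\<close> of the box without its centre, and those of type
  \<open>\<cc>\<close> form the rows \<open>h > 0\<close>, which evenness and periodicity in \<open>j\<close> match with the rows \<open>h < 0\<close>.
\<close>
lemma sum_primaries_fold:
  assumes f: "\<And>x. f (- x) = f x" "\<And>h j. f (h, j + int (nu n)) = f (h, j)"
    and g: "\<And>x. g (- x) = g x"
    and Ff: "\<And>i. F (Prim_a i) = f (0, int i)" "\<And>h j. F (Prim_c h j) = f (int h, int j)"
    and Fg: "\<And>l. F (Prim_d l) = g (int l)"
  shows "(\<Sum>l\<in>primaries n. F l) = F Prim_0 + F Prim_b
     + (sum f (boxK n) - f 0) / 2 + (sum g (boxG n) - g 0) / (2 :: complex)"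
proof -
  have row: "(\<Sum>j\<in>{- int n..int n}. f (h, j)) = (\<Sum>j\<in>{..<nu n}. f (h, int j))" for h
  proof -
    have "(\<Sum>j\<in>{- int n..int n}. f (h, j)) = (\<Sum>j\<in>{0..<int (nu n)}. f (h, j))"
      using sum_residues_symmetric[where f = "\<lambda>j. f (h, j)" and v = 0 and n = n] f(2)
      unfolding nu_def by simp
    also have "\<dots> = (\<Sum>j\<in>{..<nu n}. f (h, int j))"
      by (rule sum.reindex_bij_witness[of _ int nat]) auto
    finally show ?thesis .
  qed
  have neg: "(\<Sum>j\<in>{- int n..int n}. f (- h, j)) = (\<Sum>j\<in>{- int n..int n}. f (h, j))" for h
    by (rule sum.reindex_bij_witness[of _ uminus uminus]) (use f(1) in auto, (metis f(1) uminus_Pair minus_minus))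
  have zero: "(\<Sum>j\<in>{- int n..int n}. f (0, j)) = f 0 + 2 * (\<Sum>i\<in>{1..n}. f (0, int i))"
  proof -
    have "f (0, - j) = f (0, j)" for j using f(1)[of "(0, j)"] by simp
    then show ?thesis by (simp add: sum_symmetric_interval sum_distrib_left zero_prod_def flip: mult_2)
  qed
  have "sum f (boxK n) = (\<Sum>h\<in>{- int n..int n}. \<Sum>j\<in>{- int n..int n}. f (h, j))"
    by (simp add: boxK_def sum.cartesian_product)
  also have "\<dots> = f 0 + 2 * (\<Sum>i\<in>{1..n}. f (0, int i))
      + (\<Sum>h\<in>{1..n}. 2 * (\<Sum>j\<in>{- int n..int n}. f (int h, j)))"
    unfolding sum_symmetric_interval[where f = "\<lambda>h. \<Sum>j\<in>{- int n..int n}. f (h, j)"] neg zero mult_2 ..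
  also have "\<dots> = f 0 + 2 * (\<Sum>i\<in>{1..n}. f (0, int i)) + 2 * (\<Sum>h\<in>{1..n}. \<Sum>j\<in>{..<nu n}. f (int h, int j))"
    unfolding row by (simp add: sum_distrib_left)
  finally have "sum f (boxK n) = \<dots>" .
  moreover have "sum g (boxG n) = g 0 + 2 * (\<Sum>l\<in>{1..em n}. g (int l))"
    unfolding boxG_def by (simp add: sum_symmetric_interval g sum_distrib_left flip: mult_2)
  ultimately show ?thesis by (simp add: sum_primaries Ff Fg)
qed

lemma S_0: "S_mat n \<omega> p Prim_0 = normK n * wtK p - normG n * wtG p"
  and S_b: "S_mat n \<omega> p Prim_b = normK n * wtK p + normG n * wtG p"
  by (simp_all add: S_glue)

lemma S_sym: "S_mat n \<omega> p q = S_mat n \<omega> q p"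
  unfolding S_glue K.evenb_sym[of _ _ "pointK p"] \<Gamma>.evenb_sym[of _ "pointG p"] by simp

text \<open>
  The identity \<open>\<mu> = \<nu>\<^sup>2 + 4\<close>, in the form in which it makes the fusion coefficients integral.
\<close>
lemma normK_normG: "(normK n)\<^sup>2 - (normG n)\<^sup>2 = 4 * (normK n)\<^sup>2 * (normG n)\<^sup>2"
proof -
  have "(1 / real (nu n))\<^sup>2 - (1 / sqrt (real (mu n)))\<^sup>2
      = 4 * (1 / real (nu n))\<^sup>2 * (1 / sqrt (real (mu n)))\<^sup>2"
    using mu_pos(1)[of n] by (simp add: power_divide mu_eq_nu divide_simps del: mu_pos)
  from arg_cong[OF this, of complex_of_real] show ?thesis
    unfolding normK_def normG_def by (simp only: of_real_diff of_real_mult of_real_power of_real_numeral)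
qed

lemma normK_nonzero: "normK n \<noteq> 0" and normG_nonzero: "normG n \<noteq> 0"
  by (simp_all add: normK_def normG_def)

lemma normK_sq: "(normK n)\<^sup>2 * of_nat (card (boxK n)) = 1"
  by (simp add: normK_def card_boxK power_divide)

lemma normG_sq: "(normG n)\<^sup>2 * of_nat (card (boxG n)) = 1"
  by (simp add: normG_def card_boxG power_divide flip: of_real_power)

text \<open>
  The terms of \<open>0\<close> and \<open>\<bb>\<close> add up to half the contributions of the two neutral elements, because the cross
  terms between \<open>K\<close> and \<open>\<Gamma>\<close> cancel. With constant weight this computes \<open>S\<^sup>2\<close>, with the weight \<open>T\<close> it computes
  \<open>S T S\<close>.
\<close>
lemma sum_SS_weighted:
  assumes W: "W Prim_0 = 1" "W Prim_b = 1" "\<And>i. W (Prim_a i) = \<tau> (0, int i)"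
      "\<And>h j. W (Prim_c h j) = \<tau> (int h, int j)" "\<And>l. W (Prim_d l) = \<tau>' (int l)"
    and \<tau>: "\<And>x. \<tau> (- x) = \<tau> x" "\<And>h j. \<tau> (h, j + int (nu n)) = \<tau> (h, j)" "\<tau> 0 = 1"
    and \<tau>': "\<And>x. \<tau>' (- x) = \<tau>' x" "\<tau>' 0 = 1"
  shows "(\<Sum>l\<in>primaries n. S_mat n \<omega> p l * S_mat n \<omega> q l * W l)
    = (normK n)\<^sup>2 / 2 * wtK p * wtK q * (\<Sum>x\<in>boxK n. \<tau> x * K.evenb n \<omega> (pointK p) x * K.evenb n \<omega> (pointK q) x)
      + (normG n)\<^sup>2 / 2 * wtG p * wtG q * (\<Sum>x\<in>boxG n. \<tau>' x * \<Gamma>.evenb n (pointG p) x * \<Gamma>.evenb n (pointG q) x)"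
proof -
  define f where "f x = (normK n)\<^sup>2 * wtK p * wtK q * (\<tau> x * K.evenb n \<omega> (pointK p) x * K.evenb n \<omega> (pointK q) x)" for x
  define g where "g x = (normG n)\<^sup>2 * wtG p * wtG q * (\<tau>' x * \<Gamma>.evenb n (pointG p) x * \<Gamma>.evenb n (pointG q) x)" for x
  let ?F = "\<lambda>l. S_mat n \<omega> p l * S_mat n \<omega> q l * W l"
  have "(\<Sum>l\<in>primaries n. ?F l) = ?F Prim_0 + ?F Prim_b
     + (sum f (boxK n) - f 0) / 2 + (sum g (boxG n) - g 0) / 2"
    by (rule sum_primaries_fold) (simp_all add: f_def g_def \<tau> \<tau>' evenK_periodic W S_glue power2_eq_square)
  also have "?F Prim_0 + ?F Prim_b = (f 0 + g 0) / 2"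
    by (simp add: S_0 S_b W f_def g_def \<tau> \<tau>' power2_eq_square algebra_simps)
  also have "(f 0 + g 0) / 2 + (sum f (boxK n) - f 0) / 2 + (sum g (boxG n) - g 0) / 2
      = sum f (boxK n) / 2 + sum g (boxG n) / 2"
    by (simp add: field_simps)
  finally show ?thesis by (simp add: f_def g_def flip: sum_distrib_left)
qed

lemma latticeK_small:
  assumes "(h, j) \<in> latticeK n \<omega>" "\<bar>h\<bar> < int (nu n)"
  shows "h = 0" "int (nu n) dvd j"
proof -
  from assms(1) obtain r s where rs: "h = int (nu n) * r" "j = int (nu n) * s - 2 * \<omega> * r"
    by (auto simp: latticeK_def)
  have "r = 0"
  proof (rule ccontr)
    assume "r \<noteq> 0"
    then have "int (nu n) * 1 \<le> int (nu n) * \<bar>r\<bar>" by (intro mult_left_mono) auto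
    with assms(2) show False unfolding rs(1) abs_mult by simp
  qed
  with rs show "h = 0" "int (nu n) dvd j" by simp_all
qed

lemma dvd_small: "int N dvd x \<Longrightarrow> \<bar>x\<bar> < int N \<Longrightarrow> x = 0" for x
  using dvd_imp_le_int[of x "int N"] by force

definition primK :: "nat \<Rightarrow> primary \<Rightarrow> bool" where
  "primK n p \<longleftrightarrow> p \<in> primaries n \<and> (\<exists>i h j. p = Prim_a i \<or> p = Prim_c h j)"

definition primG :: "nat \<Rightarrow> primary \<Rightarrow> bool" where
  "primG n p \<longleftrightarrow> p \<in> primaries n \<and> (\<exists>l. p = Prim_d l)"

lemma primK_simps [simp]: "\<not> primK n Prim_0" "\<not> primK n Prim_b" "\<not> primK n (Prim_d l)"
  and primG_simps [simp]: "\<not> primG n Prim_0" "\<not> primG n Prim_b"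
    "\<not> primG n (Prim_a i)" "\<not> primG n (Prim_c h j)"
  by (simp_all add: primK_def primG_def)

lemma primaries_cases:
  assumes "p \<in> primaries n"
  obtains "p = Prim_0" | "p = Prim_b" | "primK n p" | "primG n p"
  using assms by (cases p) (auto simp: primK_def primG_def)

lemma primK_values: "primK n p \<Longrightarrow> wtK p = 1" "primK n p \<Longrightarrow> wtG p = 0" "primK n p \<Longrightarrow> pointG p = 0"
  by (auto simp: primK_def)

lemma primG_values: "primG n p \<Longrightarrow> wtK p = 0" "primG n p \<Longrightarrow> wtG p = - 1" "primG n p \<Longrightarrow> pointK p = 0"
  by (auto simp: primG_def)

lemma primK_cases:
  assumes "primK n p"
  obtains i where "p = Prim_a i" "1 \<le> i" "i \<le> n"
    | h j where "p = Prim_c h j" "1 \<le> h" "h \<le> n" "j < nu n"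
  using assms by (auto simp: primK_def primaries_def)

text \<open>
  Sums and differences of first coordinates are smaller than \<open>\<nu>\<close> in absolute value, so a lattice vector
  formed from them has first coordinate \<open>0\<close>; then the second coordinates are compared modulo \<open>\<nu>\<close>.
\<close>
lemma primK_reps:
  assumes "primK n p" "primK n q"
  shows "pointK p + pointK q \<notin> latticeK n \<omega>" "pointK p - pointK q \<in> latticeK n \<omega> \<longleftrightarrow> p = q"
proof -
  have nu: "int (nu n) = 2 * int n + 1" by (simp add: nu_def)
  show "pointK p + pointK q \<notin> latticeK n \<omega>"
  proof
    assume L: "pointK p + pointK q \<in> latticeK n \<omega>"
    obtain h j h' j' where k: "pointK p = (int h, int j)" "pointK q = (int h', int j')"
      and le: "h \<le> n" "h' \<le> n" and z: "h = 0 \<longrightarrow> 1 \<le> j \<and> j \<le> n" "h' = 0 \<longrightarrow> 1 \<le> j' \<and> j' \<le> n"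
      using assms by (auto elim!: primK_cases)
    have L': "(int h + int h', int j + int j') \<in> latticeK n \<omega>" using L by (simp add: k)
    have small: "\<bar>int h + int h'\<bar> < int (nu n)" using le nu by simp
    have "h = 0" "h' = 0" using latticeK_small(1)[OF L' small] by auto
    moreover have "int j + int j' = 0" if "h = 0" "h' = 0"
      by (rule dvd_small[OF latticeK_small(2)[OF L' small]]) (use z that nu in auto)
    ultimately show False using z by auto
  qed
  show "pointK p - pointK q \<in> latticeK n \<omega> \<longleftrightarrow> p = q"
  proof
    assume L: "pointK p - pointK q \<in> latticeK n \<omega>"
    obtain h j h' j' where k: "pointK p = (int h, int j)" "pointK q = (int h', int j')"
      and p: "p = (if h = 0 then Prim_a j else Prim_c h j)" "q = (if h' = 0 then Prim_a j' else Prim_c h' j')"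
      and le: "h \<le> n" "h' \<le> n" "j < nu n" "j' < nu n"
      using assms by (auto elim!: primK_cases) (force simp: nu_def)+
    have L': "(int h - int h', int j - int j') \<in> latticeK n \<omega>" using L by (simp add: k)
    have small: "\<bar>int h - int h'\<bar> < int (nu n)" using le nu by simp
    have "h = h'" using latticeK_small(1)[OF L' small] by simp
    moreover have "int j - int j' = 0"
      by (rule dvd_small[OF latticeK_small(2)[OF L' small]]) (use le in auto)
    ultimately show "p = q" using p by simp
  qed (simp add: K.zero_L)
qed

lemma primG_reps:
  assumes "primG n p" "primG n q"
  shows "pointG p + pointG q \<notin> latticeG n" "pointG p - pointG q \<in> latticeG n \<longleftrightarrow> p = q"
proof -
  obtain l l' where l: "p = Prim_d l" "q = Prim_d l'" "1 \<le> l" "l \<le> em n" "1 \<le> l'" "l' \<le> em n"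
    using assms by (auto simp: primG_def primaries_def)
  show "pointG p + pointG q \<notin> latticeG n" "pointG p - pointG q \<in> latticeG n \<longleftrightarrow> p = q"
    using l dvd_small[of "mu n" "int l + int l'"] dvd_small[of "mu n" "int l - int l'"]
    by (auto simp: latticeG_def mu_def)
qed

lemma primK_notin: "primK n p \<Longrightarrow> pointK p \<notin> latticeK n \<omega>"
  using primK_reps(1)[of n p p] K.add_L[where u = "pointK p" and v = "pointK p"] by blast

lemma primG_notin: "primG n p \<Longrightarrow> pointG p \<notin> latticeG n"
  using primG_reps(1)[of n p p] \<Gamma>.add_L[where u = "pointG p" and v = "pointG p"] by blast

lemma gluing_delta:
  assumes "p \<in> primaries n" "q \<in> primaries n"
  shows "wtK p * wtK q * (of_bool (pointK p + pointK q \<in> latticeK n \<omega>) + of_bool (pointK p - pointK q \<in> latticeK n \<omega>))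
    + wtG p * wtG q * (of_bool (pointG p + pointG q \<in> latticeG n) + of_bool (pointG p - pointG q \<in> latticeG n)) = of_bool (p = q)"
proof -
  have ne: "p \<noteq> q" if "primK n p" "primG n q" for p q
    using that by (auto simp: primK_def primG_def)
  show ?thesis
    by (rule primaries_cases[OF assms(1)]; rule primaries_cases[OF assms(2)])
       (auto simp: primK_values primG_values primK_reps primG_reps primK_notin primG_notin
          K.zero_L \<Gamma>.zero_L K.minus_L_iff \<Gamma>.minus_L_iff dest: ne)
qed

lemma S_squared:
  assumes "p \<in> primaries n" "q \<in> primaries n"
  shows "(\<Sum>l\<in>primaries n. S_mat n \<omega> p l * S_mat n \<omega> q l) = of_bool (p = q)"
proof -
  have "(\<Sum>l\<in>primaries n. S_mat n \<omega> p l * S_mat n \<omega> q l)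
    = (normK n)\<^sup>2 / 2 * wtK p * wtK q * (\<Sum>x\<in>boxK n. K.evenb n \<omega> (pointK p) x * K.evenb n \<omega> (pointK q) x)
      + (normG n)\<^sup>2 / 2 * wtG p * wtG q * (\<Sum>x\<in>boxG n. \<Gamma>.evenb n (pointG p) x * \<Gamma>.evenb n (pointG q) x)"
    using sum_SS_weighted[of "\<lambda>_. 1" "\<lambda>_. 1" "\<lambda>_. 1"] by simp
  also have "\<dots> = (normK n)\<^sup>2 * of_nat (card (boxK n)) * (wtK p * wtK q * (of_bool (pointK p + pointK q \<in> latticeK n \<omega>) + of_bool (pointK p - pointK q \<in> latticeK n \<omega>)))
    + (normG n)\<^sup>2 * of_nat (card (boxG n)) * (wtG p * wtG q * (of_bool (pointG p + pointG q \<in> latticeG n) + of_bool (pointG p - pointG q \<in> latticeG n)))"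
    unfolding K.sum_evenb2 \<Gamma>.sum_evenb2 by (simp add: mult_ac)
  also have "\<dots> = of_bool (p = q)"
    unfolding normK_sq normG_sq mult_1_left using assms by (rule gluing_delta)
  finally show ?thesis .
qed

lemma T_values: "T_entry n \<omega> (Prim_a i) = quadK n \<omega> (0, int i)"
    "T_entry n \<omega> (Prim_c h j) = quadK n \<omega> (int h, int j)" "T_entry n \<omega> (Prim_d l) = quadG n (int l)"
  unfolding T_entry.simps ee_exp quadK_def quadG_def by simp_all

lemma T_K: "wtK p * T_entry n \<omega> p = wtK p * quadK n \<omega> (pointK p)"
  by (cases p) (simp_all add: K.t_zero T_values del: T_entry.simps(3-5))

lemma T_G: "wtG p * T_entry n \<omega> p = wtG p * quadG n (pointG p)"
  by (cases p) (simp_all add: \<Gamma>.t_zero T_values del: T_entry.simps(3-5))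

lemma wtK_cnj: "cnj (wtK p) = wtK p" and wtG_cnj: "cnj (wtG p) = wtG p"
  by (cases p; simp)+

lemma S_T_S:
  "(\<Sum>l\<in>primaries n. S_mat n \<omega> p l * S_mat n \<omega> q l * T_entry n \<omega> l)
     = cnj (T_entry n \<omega> p) * cnj (T_entry n \<omega> q) * S_mat n \<omega> p q"
proof -
  have cT: "wtK p * cnj (T_entry n \<omega> p) = wtK p * cnj (quadK n \<omega> (pointK p))"
    "wtG p * cnj (T_entry n \<omega> p) = wtG p * cnj (quadG n (pointG p))" for p
    using arg_cong[OF T_K[of p n \<omega>], of cnj] arg_cong[OF T_G[of p n \<omega>], of cnj]
    by (simp_all add: wtK_cnj wtG_cnj)
  have a: "(normK n)\<^sup>2 * of_nat (nu n) = normK n" by (simp add: normK_def power2_eq_square)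
  have "(1 / sqrt (real (mu n)))\<^sup>2 * sqrt (real (mu n)) = 1 / sqrt (real (mu n))"
    by (simp add: power2_eq_square del: real_sqrt_mult_self)
  from arg_cong[OF this, of complex_of_real] have b: "(normG n)\<^sup>2 * of_real (sqrt (real (mu n))) = normG n"
    unfolding normG_def by (simp only: of_real_mult of_real_power)
  have "(\<Sum>l\<in>primaries n. S_mat n \<omega> p l * S_mat n \<omega> q l * T_entry n \<omega> l)
    = (normK n)\<^sup>2 / 2 * wtK p * wtK q * (\<Sum>x\<in>boxK n. quadK n \<omega> x * K.evenb n \<omega> (pointK p) x * K.evenb n \<omega> (pointK q) x)
      + (normG n)\<^sup>2 / 2 * wtG p * wtG q * (\<Sum>x\<in>boxG n. quadG n x * \<Gamma>.evenb n (pointG p) x * \<Gamma>.evenb n (pointG q) x)"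
    by (rule sum_SS_weighted) (simp_all only: T_values T_entry.simps(1,2) K.t_minus \<Gamma>.t_minus K.t_zero \<Gamma>.t_zero quadK_periodic)
  also have "\<dots> = ((normK n)\<^sup>2 * of_nat (nu n)) * (wtK p * cnj (quadK n \<omega> (pointK p))) * (wtK q * cnj (quadK n \<omega> (pointK q))) * K.evenb n \<omega> (pointK p) (pointK q)
     - ((normG n)\<^sup>2 * of_real (sqrt (real (mu n)))) * (wtG p * cnj (quadG n (pointG p))) * (wtG q * cnj (quadG n (pointG q))) * \<Gamma>.evenb n (pointG p) (pointG q)"
    unfolding K.sum_t_evenb2 \<Gamma>.sum_t_evenb2 by (simp add: mult_ac)
  also have "\<dots> = cnj (T_entry n \<omega> p) * cnj (T_entry n \<omega> q) * S_mat n \<omega> p q"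
    unfolding a b cT[symmetric] S_glue by (simp add: algebra_simps)
  finally show ?thesis .
qed

text \<open>
  The contributions of \<open>0\<close> and \<open>\<bb>\<close> to the Verlinde sum, for \<open>a = 1/\<nu>\<close> and \<open>b = 1/sqrt \<mu>\<close>. After clearing
  denominators only the powers \<open>a ^ 4\<close>, \<open>a\<^sup>2 * b\<^sup>2\<close> and \<open>b ^ 4\<close> occur; the relation between \<open>a\<close> and \<open>b\<close>
  rewrites the fourth powers so that \<open>a\<^sup>2 * b\<^sup>2\<close> can be cancelled.
\<close>
lemma verlinde_algebra:
  fixes a b :: complex
  assumes ab: "a\<^sup>2 - b\<^sup>2 = 4 * a\<^sup>2 * b\<^sup>2" and "a \<noteq> 0" "b \<noteq> 0"
  shows "(a * x - b * x') * (a * y - b * y') * (a * z - b * z') / ((a - b) / 2)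
       + (a * x + b * x') * (a * y + b * y') * (a * z + b * z') / ((a + b) / 2)
       = 4 * a\<^sup>2 * x * y * z + 4 * b\<^sup>2 * x' * y' * z' + (x - x') * (y - y') * (z - z')"
proof -
  have "(a - b) * (a + b) \<noteq> 0" using assms by (simp add: power2_eq_square algebra_simps)
  then have ne: "a - b \<noteq> 0" "a + b \<noteq> 0" by auto
  have quartic: "a ^ 4 = a\<^sup>2 * b\<^sup>2 + 4 * a\<^sup>2 * (a\<^sup>2 * b\<^sup>2)" "b ^ 4 = a\<^sup>2 * b\<^sup>2 - 4 * b\<^sup>2 * (a\<^sup>2 * b\<^sup>2)"
    using ab by algebra+
  let ?R = "4 * a\<^sup>2 * x * y * z + 4 * b\<^sup>2 * x' * y' * z' + (x - x') * (y - y') * (z - z')"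
  have "2 * (a + b) * ((a * x - b * x') * (a * y - b * y') * (a * z - b * z'))
      + 2 * (a - b) * ((a * x + b * x') * (a * y + b * y') * (a * z + b * z'))
      = 4 * (a ^ 4 * (x * y * z) + a\<^sup>2 * b\<^sup>2 * (x * y' * z' + x' * y * z' + x' * y' * z)
        - b ^ 4 * (x' * y' * z') - a\<^sup>2 * b\<^sup>2 * (x' * y * z + x * y' * z + x * y * z'))"
    by algebra
  also have "\<dots> = 4 * a\<^sup>2 * b\<^sup>2 * ?R"
    unfolding quartic by algebra
  also have "\<dots> = (a - b) * (a + b) * ?R"
    unfolding ab[symmetric] by algebra
  finally have "2 * (a + b) * ((a * x - b * x') * (a * y - b * y') * (a * z - b * z'))
      + 2 * (a - b) * ((a * x + b * x') * (a * y + b * y') * (a * z + b * z')) = (a - b) * (a + b) * ?R" .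
  moreover have "P / (d / 2) + Q / (e / 2) = R"
    if "2 * e * P + 2 * d * Q = d * e * R" "d \<noteq> 0" "e \<noteq> 0" for P Q R d e :: complex
  proof -
    have "P / (d / 2) + Q / (e / 2) = (2 * e * P + 2 * d * Q) / (d * e)"
      using that(2,3) by (simp add: field_simps)
    then show ?thesis using that by simp
  qed
  ultimately show ?thesis using ne by blast
qed

text \<open>
  By how much a fusion coefficient of nonzero labels exceeds its generic value \<open>1\<close>.
\<close>
definition excess :: "nat \<Rightarrow> int \<Rightarrow> primary \<Rightarrow> primary \<Rightarrow> primary \<Rightarrow> complex" where
  "excess n \<omega> x y z = wtK x * wtK y * wtK z * of_nat (K.nsol n \<omega> (pointK x) (pointK y) (pointK z))
     + wtG x * wtG y * wtG z * of_nat (\<Gamma>.nsol n (pointG x) (pointG y) (pointG z))"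

lemma verlinde:
  "(\<Sum>l\<in>primaries n. S_mat n \<omega> x l * S_mat n \<omega> y l * S_mat n \<omega> z l / S_mat n \<omega> Prim_0 l)
     = of_bool (Prim_0 \<notin> {x, y, z}) + excess n \<omega> x y z"
proof -
  define f where "f u = (normK n)\<^sup>2 * wtK x * wtK y * wtK z
    * (K.evenb n \<omega> (pointK x) u * K.evenb n \<omega> (pointK y) u * K.evenb n \<omega> (pointK z) u)" for u
  define g where "g u = (normG n)\<^sup>2 * wtG x * wtG y * wtG z
    * (\<Gamma>.evenb n (pointG x) u * \<Gamma>.evenb n (pointG y) u * \<Gamma>.evenb n (pointG z) u)" for u
  let ?F = "\<lambda>l. S_mat n \<omega> x l * S_mat n \<omega> y l * S_mat n \<omega> z l / S_mat n \<omega> Prim_0 l"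
  have "(\<Sum>l\<in>primaries n. ?F l) = ?F Prim_0 + ?F Prim_b
     + (sum f (boxK n) - f 0) / 2 + (sum g (boxG n) - g 0) / 2"
    by (rule sum_primaries_fold)
       (simp_all add: f_def g_def evenK_periodic S_glue power2_eq_square normK_nonzero normG_nonzero)
  also have "?F Prim_0 + ?F Prim_b = 4 * (normK n)\<^sup>2 * wtK x * wtK y * wtK z + 4 * (normG n)\<^sup>2 * wtG x * wtG y * wtG z
      + (wtK x - wtG x) * (wtK y - wtG y) * (wtK z - wtG z)"
    using verlinde_algebra[OF normK_normG normK_nonzero normG_nonzero]
    by (simp add: S_0 S_b diff_divide_distrib add_divide_distrib)
  also have "(wtK x - wtG x) * (wtK y - wtG y) * (wtK z - wtG z) = of_bool (Prim_0 \<notin> {x, y, z})"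
  proof -
    have "wtK p - wtG p = of_bool (p \<noteq> Prim_0)" for p by (cases p) simp_all
    then show ?thesis by auto
  qed
  also have "4 * (normK n)\<^sup>2 * wtK x * wtK y * wtK z + 4 * (normG n)\<^sup>2 * wtG x * wtG y * wtG z
      = (f 0 + g 0) / 2"
    by (simp add: f_def g_def field_simps)
  also have "(f 0 + g 0) / 2 + of_bool (Prim_0 \<notin> {x, y, z}) + (sum f (boxK n) - f 0) / 2 + (sum g (boxG n) - g 0) / 2
      = sum f (boxK n) / 2 + sum g (boxG n) / 2 + of_bool (Prim_0 \<notin> {x, y, z})"
    by (simp add: field_simps del: of_bool_eq_iff)
  finally have "(\<Sum>l\<in>primaries n. ?F l)
      = sum f (boxK n) / 2 + sum g (boxG n) / 2 + of_bool (Prim_0 \<notin> {x, y, z})" .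
  moreover have "sum f (boxK n) / 2 = (normK n)\<^sup>2 * of_nat (card (boxK n))
      * (wtK x * wtK y * wtK z * of_nat (K.nsol n \<omega> (pointK x) (pointK y) (pointK z)))"
    unfolding f_def sum_distrib_left[symmetric] K.sum_evenb3 by simp
  moreover have "sum g (boxG n) / 2 = (normG n)\<^sup>2 * of_nat (card (boxG n))
      * (wtG x * wtG y * wtG z * of_nat (\<Gamma>.nsol n (pointG x) (pointG y) (pointG z)))"
    unfolding g_def sum_distrib_left[symmetric] \<Gamma>.sum_evenb3 by simp
  ultimately show ?thesis unfolding normK_sq normG_sq by (simp add: excess_def)
qed

section \<open>The fusion coefficients\<close>

text \<open>
  Since the exceptional triples are multisets, a case distinction over them yields the labels only up to
  order; this transfers symmetric predicates.
\<close>
lemma permuted_triple: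
  assumes "{#a, b, c#} = {#x, y, z#}" "P a b c"
    and "\<And>x y z. P x y z \<Longrightarrow> P y x z" "\<And>x y z. P x y z \<Longrightarrow> P x z y"
  shows "P x y z"
proof -
  have pair: "{#u, v#} = {#u', v'#} \<longleftrightarrow> u = u' \<and> v = v' \<or> u = v' \<and> v = u'" for u v u' v' :: 'a
    by (auto simp: add_eq_conv_ex)
  have "a \<in># {#x, y, z#}" by (simp flip: assms(1))
  then consider "a = x" | "a = y" | "a = z" by auto
  then show ?thesis
  proof cases
    case 1
    then have "{#b, c#} = {#y, z#}" using assms(1) by simp
    then show ?thesis using 1 assms(2-4) unfolding pair by blast
  next
    case 2
    then have "{#b, c#} = {#x, z#}" using assms(1) by (simp add: add_mset_commute[of x])
    then show ?thesis using 2 assms(2-4) unfolding pair by blast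
  next
    case 3
    then have "{#b, c#} = {#x, y#}"
      using assms(1) by (simp add: add_mset_commute[of x z] add_mset_commute[of y z])
    then show ?thesis using 3 assms(2-4) unfolding pair by blast
  qed
qed

lemma excess_sym: "excess n \<omega> x y z = excess n \<omega> y x z" "excess n \<omega> x y z = excess n \<omega> x z y"
  unfolding excess_def by (simp_all add: K.nsol_sym \<Gamma>.nsol_sym mult_ac)

text \<open>
  The carry \<open>2 * \<omega> * H / \<nu>\<close> in the rule for three labels of type \<open>\<cc>\<close> comes from the lattice generator \<open>(\<nu>, - 2 * \<omega>)\<close>.
\<close>
lemma latticeK_mem:
  "(H, J) \<in> latticeK n \<omega> \<longleftrightarrow> int (nu n) dvd H \<and> int (nu n) dvd J + (2 * \<omega> * H) div int (nu n)"
proof (cases "int (nu n) dvd H")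
  case True
  then obtain r where H: "H = int (nu n) * r" ..
  have "2 * \<omega> * H = int (nu n) * (2 * \<omega> * r)" by (simp add: H)
  then have "(2 * \<omega> * H) div int (nu n) = 2 * \<omega> * r" by (simp only:) simp
  then show ?thesis using latticeK_iff[of n r J \<omega>] by (simp add: H add.commute mult.assoc)
next
  case False
  then show ?thesis by (auto simp: latticeK_def)
qed

lemma K_nsol_iff:
  "K.nsol n \<omega> (h, j) (h', j') (h'', j'') \<noteq> 0 \<longleftrightarrow>
     (\<exists>s\<in>{1, -1}. \<exists>s'\<in>{1, -1}. (s * h + s' * h' - h'', s * j + s' * j' - j'') \<in> latticeK n \<omega>)"
  unfolding K.nsol_pos_iff by simp

lemma G_nsol_iff:
  "\<Gamma>.nsol n l l' l'' \<noteq> 0 \<longleftrightarrow> (\<exists>s\<in>{1, -1}. \<exists>s'\<in>{1, -1}. int (mu n) dvd s * l + s' * l' - l'')"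
  unfolding \<Gamma>.nsol_pos_iff by (simp add: latticeG_def)

lemma excess_K:
  assumes "primK n x" "primK n y" "primK n z"
  shows "excess n \<omega> x y z = of_bool (K.nsol n \<omega> (pointK x) (pointK y) (pointK z) \<noteq> 0)"
proof -
  have "K.nsol n \<omega> (pointK x) (pointK y) (pointK z) \<le> 1"
    using assms by (intro K.nsol_le_1 primK_notin)
  then have "K.nsol n \<omega> (pointK x) (pointK y) (pointK z) = 0 \<or> K.nsol n \<omega> (pointK x) (pointK y) (pointK z) = 1" by linarith
  then show ?thesis using assms by (auto simp: excess_def primK_values)
qed

lemma excess_G:
  assumes "primG n x" "primG n y" "primG n z"
  shows "excess n \<omega> x y z = - of_bool (\<Gamma>.nsol n (pointG x) (pointG y) (pointG z) \<noteq> 0)"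
proof -
  have "\<Gamma>.nsol n (pointG x) (pointG y) (pointG z) \<le> 1"
    using assms by (intro \<Gamma>.nsol_le_1 primG_notin)
  then have "\<Gamma>.nsol n (pointG x) (pointG y) (pointG z) = 0 \<or> \<Gamma>.nsol n (pointG x) (pointG y) (pointG z) = 1" by linarith
  then show ?thesis using assms by (auto simp: excess_def primG_values)
qed

lemma excess_bK:
  assumes "primK n p"
  shows "excess n \<omega> Prim_b p p = 1"
  using assms primK_reps[of n p p \<omega>] K.nsol_zero[where u = "pointK p" and v = "pointK p" and n = n and \<omega> = \<omega>]
  by (simp add: excess_def primK_values)

lemma excess_bG:
  assumes "primG n p"
  shows "excess n \<omega> Prim_b p p = - 1"
  using assms primG_reps[of n p p] \<Gamma>.nsol_zero[where u = "pointG p" and v = "pointG p" and n = n]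
  by (simp add: excess_def primG_values)

text \<open>
  Mixed triples have no excess, since one of the weights vanishes in each summand; with two or three labels
  \<open>\<bb>\<close> the summands of \<open>K\<close> and \<open>\<Gamma>\<close> either cancel or are zero.
\<close>
lemma excess_nonzero_cases:
  assumes "excess n \<omega> x y z \<noteq> 0"
    and "x \<in> primaries n - {Prim_0}" "y \<in> primaries n - {Prim_0}" "z \<in> primaries n - {Prim_0}"
  shows "primK n x \<and> primK n y \<and> primK n z \<or> primG n x \<and> primG n y \<and> primG n z
    \<or> (\<exists>p. (primK n p \<or> primG n p) \<and> {#x, y, z#} = {#Prim_b, p, p#})"
proof -
  have c: "x = Prim_b \<or> primK n x \<or> primG n x" if "x \<in> primaries n - {Prim_0}" for x
    using that by (auto elim: primaries_cases)
  have bbb: "excess n \<omega> Prim_b Prim_b Prim_b = 0"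
    by (simp add: excess_def K.nsol_def \<Gamma>.nsol_def K.zero_L \<Gamma>.zero_L)
  have bb: "excess n \<omega> Prim_b Prim_b p = 0" if "primK n p \<or> primG n p" for p
    using that by (auto simp: excess_def primK_values primG_values K.nsol_def \<Gamma>.nsol_def
      K.minus_L_iff \<Gamma>.minus_L_iff primK_notin primG_notin)
  have bpb: "excess n \<omega> Prim_b p Prim_b = 0" if "primK n p \<or> primG n p" for p
    using bb[OF that] excess_sym(2)[of n \<omega> Prim_b p Prim_b] by simp
  have KG: "excess n \<omega> x y z = 0" if "primK n p" "primG n q" "p \<in> {x, y, z}" "q \<in> {x, y, z}" for p q x y z
    using that by (auto simp: excess_def primK_values primG_values primK_def primG_def)
  have b: "p = q" if "excess n \<omega> Prim_b p q \<noteq> 0" "primK n p \<and> primK n q \<or> primG n p \<and> primG n q" for p q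
  proof (rule ccontr)
    assume "p \<noteq> q"
    then have "excess n \<omega> Prim_b p q = 0"
      using that(2) K.nsol_zero_distinct[where u = "pointK p" and v = "pointK q" and n = n and \<omega> = \<omega>]
        \<Gamma>.nsol_zero_distinct[where u = "pointG p" and v = "pointG q" and n = n]
      by (auto simp: excess_def primK_values primG_values primK_reps primG_reps)
    with that(1) show False ..
  qed
  define Q where "Q x y z \<longleftrightarrow> (excess n \<omega> x y z \<noteq> 0 \<longrightarrow>
    primK n x \<and> primK n y \<and> primK n z \<or> primG n x \<and> primG n y \<and> primG n z
    \<or> (\<exists>p. (primK n p \<or> primG n p) \<and> {#x, y, z#} = {#Prim_b, p, p#}))" for x y z
  have Q1: "Q y x z" if "Q x y z" for x y z
    using that unfolding Q_def excess_sym(1)[of n \<omega> x y z] by (auto simp: add_mset_commute)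
  have Q2: "Q x z y" if "Q x y z" for x y z
    using that unfolding Q_def excess_sym(2)[of n \<omega> x y z] by (auto simp: add_mset_commute)
  have Qb: "Q Prim_b p q" if "p = Prim_b \<or> primK n p \<or> primG n p" "q = Prim_b \<or> primK n q \<or> primG n q" for p q
  proof -
    from that consider "p = Prim_b" "q = Prim_b" | "p = Prim_b" "primK n q \<or> primG n q"
      | "q = Prim_b" "primK n p \<or> primG n p"
      | "primK n p \<and> primG n q \<or> primG n p \<and> primK n q"
      | "primK n p \<and> primK n q \<or> primG n p \<and> primG n q" by auto
    then show ?thesis
    proof cases
      case 4
      then have "excess n \<omega> Prim_b p q = 0" using KG[of p q Prim_b p q] KG[of q p Prim_b p q] by auto
      then show ?thesis by (simp add: Q_def)
    next
      case 5
      then show ?thesis unfolding Q_def using b[OF _ 5] by auto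
    qed (simp_all add: Q_def bbb bb bpb)
  qed
  note types = c[OF assms(2)] c[OF assms(3)] c[OF assms(4)]
  have "Q x y z"
  proof (cases "Prim_b \<in> {x, y, z}")
    case True
    then consider "x = Prim_b" | "y = Prim_b" | "z = Prim_b" by auto
    then show ?thesis
    proof cases
      case 1
      then show ?thesis using Qb[OF types(2,3)] by simp
    next
      case 2
      then show ?thesis using Q1[OF Qb[OF types(1,3)]] by simp
    next
      case 3
      then show ?thesis using Q2[OF Q1[OF Qb[OF types(1,2)]]] by simp
    qed
  next
    case False
    then have KorG: "primK n x \<or> primG n x" "primK n y \<or> primG n y" "primK n z \<or> primG n z"
      using types by auto
    have "\<not> (primK n p \<and> primG n q)" if "p \<in> {x, y, z}" "q \<in> {x, y, z}" for p q
      using KG[of p q x y z] that assms(1) by auto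
    from this[of x y] this[of x z] this[of y x] this[of y z] this[of z x] this[of z y] KorG
    show ?thesis unfolding Q_def by auto
  qed
  then show ?thesis using assms(1) by (simp add: Q_def)
qed

lemma fusion_two_excess:
  assumes "fusion_two n \<omega> {#x, y, z#}" "x \<in> primaries n" "y \<in> primaries n" "z \<in> primaries n"
  shows "excess n \<omega> x y z = 1"
proof -
  define P where "P x y z \<longleftrightarrow> (x \<in> primaries n \<longrightarrow> y \<in> primaries n \<longrightarrow> z \<in> primaries n \<longrightarrow> excess n \<omega> x y z = 1)" for x y z
  have P1: "P y x z" if "P x y z" for x y z using that excess_sym(1)[of n \<omega> x y z] by (simp add: P_def)
  have P2: "P x z y" if "P x y z" for x y z using that excess_sym(2)[of n \<omega> x y z] by (simp add: P_def)
  have perm: "P x y z" if "{#x, y, z#} = {#a, b, c#}" "P a b c" for a b c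
    by (rule permuted_triple[where P = P, OF that(1)[symmetric] that(2) P1 P2])
  have K: "primK n (Prim_a i)" if "Prim_a i \<in> primaries n" for i using that by (simp add: primK_def)
  have K': "primK n (Prim_c h i)" if "Prim_c h i \<in> primaries n" for h i using that by (simp add: primK_def)
  have nsol: "P x y z" if "K.nsol n \<omega> (pointK x) (pointK y) (pointK z) \<noteq> 0"
    "x \<in> primaries n \<Longrightarrow> primK n x" "y \<in> primaries n \<Longrightarrow> primK n y" "z \<in> primaries n \<Longrightarrow> primK n z" for x y z
    using that excess_K[of n x y z \<omega>] by (simp add: P_def)
  have "P x y z"
    using assms(1)
  proof (cases rule: fusion_two.cases)
    case (baa i)
    then have "P Prim_b (Prim_a i) (Prim_a i)" by (simp add: P_def excess_bK K)
    then show ?thesis by (rule perm[OF baa])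
  next
    case (bcc h i)
    then have "P Prim_b (Prim_c h i) (Prim_c h i)" by (simp add: P_def excess_bK K')
    then show ?thesis by (rule perm[OF bcc])
  next
    case (aaa s s' k i j)
    have "int (nu n) dvd s * int i + s' * int j - int k"
      using cong_sym[OF aaa(4)] by (simp add: cong_iff_dvd_diff)
    then have "K.nsol n \<omega> (pointK (Prim_a i)) (pointK (Prim_a j)) (pointK (Prim_a k)) \<noteq> 0"
      unfolding pointK.simps K_nsol_iff latticeK_mem using aaa(2,3)
      by (intro bexI[of _ s] bexI[of _ s']) simp_all
    then have "P (Prim_a i) (Prim_a j) (Prim_a k)" using K K K by (rule nsol)
    then show ?thesis by (rule perm[OF aaa(1)])
  next
    case (ccc s s' h'' h h' k i j)
    have "int (nu n) dvd s * int h + s' * int h' - int h''"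
      using cong_sym[OF ccc(4)] by (simp add: cong_iff_dvd_diff)
    moreover have "int (nu n) dvd (s * int i + s' * int j - int k)
        + (2 * \<omega> * (s * int h + s' * int h' - int h'')) div int (nu n)"
      using cong_sym[OF ccc(5)] by (simp add: cong_iff_dvd_diff algebra_simps)
    ultimately have "K.nsol n \<omega> (pointK (Prim_c h i)) (pointK (Prim_c h' j)) (pointK (Prim_c h'' k)) \<noteq> 0"
      unfolding pointK.simps K_nsol_iff latticeK_mem using ccc(2,3) by blast
    then have "P (Prim_c h i) (Prim_c h' j) (Prim_c h'' k)" using K' K' K' by (rule nsol)
    then show ?thesis by (rule perm[OF ccc(1)])
  next
    case (acc s i j k h)
    have "int (nu n) dvd s * int i - (int j - int k)"
      using acc(3) by (simp add: cong_iff_dvd_diff)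
    then have "int (nu n) dvd - (s * int i - (int j - int k))" by (simp only: dvd_minus_iff)
    then have "int (nu n) dvd (- s) * int i + 1 * int j - int k" by (simp add: algebra_simps)
    then have "K.nsol n \<omega> (pointK (Prim_a i)) (pointK (Prim_c h j)) (pointK (Prim_c h k)) \<noteq> 0"
      unfolding pointK.simps K_nsol_iff latticeK_mem using acc(2)
      by (intro bexI[of _ "- s"] bexI[of _ 1]) auto
    then have "P (Prim_a i) (Prim_c h j) (Prim_c h k)" using K K' K' by (rule nsol)
    then show ?thesis by (rule perm[OF acc(1)])
  qed
  then show ?thesis using assms(2-4) by (simp add: P_def)
qed

lemma fusion_zero_excess:
  assumes "fusion_zero n {#x, y, z#}" "x \<in> primaries n" "y \<in> primaries n" "z \<in> primaries n"
  shows "excess n \<omega> x y z = - 1"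
proof -
  define P where "P x y z \<longleftrightarrow> (x \<in> primaries n \<longrightarrow> y \<in> primaries n \<longrightarrow> z \<in> primaries n \<longrightarrow> excess n \<omega> x y z = - 1)" for x y z
  have P1: "P y x z" if "P x y z" for x y z using that excess_sym(1)[of n \<omega> x y z] by (simp add: P_def)
  have P2: "P x z y" if "P x y z" for x y z using that excess_sym(2)[of n \<omega> x y z] by (simp add: P_def)
  have perm: "P x y z" if "{#x, y, z#} = {#a, b, c#}" "P a b c" for a b c
    by (rule permuted_triple[where P = P, OF that(1)[symmetric] that(2) P1 P2])
  have G: "primG n (Prim_d l)" if "Prim_d l \<in> primaries n" for l using that by (simp add: primG_def)
  have "P x y z"
    using assms(1)
  proof (cases rule: fusion_zero.cases)
    case (bdd l)
    then have "P Prim_b (Prim_d l) (Prim_d l)" by (simp add: P_def excess_bG G)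
    then show ?thesis by (rule perm[OF bdd])
  next
    case (ddd s s' l'' l l')
    have "int (mu n) dvd s * int l + s' * int l' - int l''"
      using cong_sym[OF ddd(4)] by (simp add: cong_iff_dvd_diff)
    then have "\<Gamma>.nsol n (pointG (Prim_d l)) (pointG (Prim_d l')) (pointG (Prim_d l'')) \<noteq> 0"
      unfolding pointG.simps G_nsol_iff using ddd(2,3) by blast
    then have "P (Prim_d l) (Prim_d l') (Prim_d l'')" by (simp add: P_def excess_G G)
    then show ?thesis by (rule perm[OF ddd(1)])
  qed
  then show ?thesis using assms(2-4) by (simp add: P_def)
qed

text \<open>
  For two labels of type \<open>\<aa>\<close> and one of type \<open>\<cc>\<close> there is no solution, as the first coordinates
  do not cancel; with one label of type \<open>\<aa>\<close> the first coordinates \<open>h\<close> must agree.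
\<close>
lemma fusion_two_if_nsol:
  assumes "primK n x" "primK n y" "primK n z" "K.nsol n \<omega> (pointK x) (pointK y) (pointK z) \<noteq> 0"
  shows "fusion_two n \<omega> {#x, y, z#}"
proof -
  define Q where "Q x y z \<longleftrightarrow> (primK n x \<longrightarrow> primK n y \<longrightarrow> primK n z \<longrightarrow>
    K.nsol n \<omega> (pointK x) (pointK y) (pointK z) \<noteq> 0 \<longrightarrow> fusion_two n \<omega> {#x, y, z#})" for x y z
  have Q1: "Q y x z" if "Q x y z" for x y z
    using that K.nsol_sym(1)[where u = "pointK x" and v = "pointK y"] by (simp add: Q_def add_mset_commute)
  have Q2: "Q x z y" if "Q x y z" for x y z
    using that K.nsol_sym(2)[where v = "pointK y" and w = "pointK z"] by (simp add: Q_def add_mset_commute)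
  have nu: "int (nu n) = 2 * int n + 1" by (simp add: nu_def)
  have bnd: "1 \<le> h \<and> h \<le> n" if "primK n (Prim_c h j)" for h j
    using that by (auto simp: primK_def primaries_def)
  have aaa: "Q (Prim_a i) (Prim_a j) (Prim_a k)" for i j k
    unfolding Q_def pointK.simps K_nsol_iff latticeK_mem
  proof (intro impI, elim bexE)
    fix s s' assume s: "s \<in> {1, - 1 :: int}" "s' \<in> {1, - 1 :: int}"
      and L: "int (nu n) dvd s * 0 + s' * 0 - 0 \<and>
        int (nu n) dvd s * int i + s' * int j - int k + 2 * \<omega> * (s * 0 + s' * 0 - 0) div int (nu n)"
    then have "[s * int i + s' * int j = int k] (mod int (nu n))" by (simp add: cong_iff_dvd_diff)
    from fusion_two.aaa[OF s cong_sym[OF this]]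
    show "fusion_two n \<omega> {#Prim_a i, Prim_a j, Prim_a k#}" .
  qed
  have aac: "Q (Prim_a i) (Prim_a j) (Prim_c h k)" for i j h k
    unfolding Q_def pointK.simps K_nsol_iff
  proof (intro impI, elim bexE)
    fix s s' :: int assume L: "(s * 0 + s' * 0 - int h, s * int i + s' * int j - int k) \<in> latticeK n \<omega>"
      and h: "primK n (Prim_c h k)"
    have "h = 0" using latticeK_small(1)[OF L] bnd[OF h] nu by simp
    then show "fusion_two n \<omega> {#Prim_a i, Prim_a j, Prim_c h k#}" using bnd[OF h] by simp
  qed
  have acc: "Q (Prim_a i) (Prim_c h j) (Prim_c h' k)" for i h j h' k
    unfolding Q_def pointK.simps K_nsol_iff
  proof (intro impI, elim bexE)
    fix s s' :: int assume s: "s \<in> {1, - 1}" "s' \<in> {1, - 1}"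
      and L: "(s * 0 + s' * int h - int h', s * int i + s' * int j - int k) \<in> latticeK n \<omega>"
      and h: "primK n (Prim_c h j)" and h': "primK n (Prim_c h' k)"
    have small: "\<bar>s * 0 + s' * int h - int h'\<bar> < int (nu n)"
      using s bnd[OF h] bnd[OF h'] nu by auto
    have eq: "s' = 1" "h' = h" using latticeK_small(1)[OF L small] s bnd[OF h] bnd[OF h'] by auto
    have "int (nu n) dvd - (s * int i + int j - int k)"
      using latticeK_small(2)[OF L small] eq by (simp only: dvd_minus_iff mult_1_left)
    then have "[- s * int i = int j - int k] (mod int (nu n))"
      by (simp add: cong_iff_dvd_diff algebra_simps)
    then show "fusion_two n \<omega> {#Prim_a i, Prim_c h j, Prim_c h' k#}"
      unfolding eq using s by (intro fusion_two.acc[where s = "- s"]) auto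
  qed
  have ccc: "Q (Prim_c h i) (Prim_c h' j) (Prim_c h'' k)" for h i h' j h'' k
    unfolding Q_def pointK.simps K_nsol_iff latticeK_mem
  proof (intro impI, elim bexE conjE)
    fix s s' assume s: "s \<in> {1, - 1 :: int}" "s' \<in> {1, - 1 :: int}"
      and L: "int (nu n) dvd s * int h + s' * int h' - int h''"
        "int (nu n) dvd s * int i + s' * int j - int k + 2 * \<omega> * (s * int h + s' * int h' - int h'') div int (nu n)"
    have h: "[s * int h + s' * int h' = int h''] (mod int (nu n))"
      using L(1) by (simp add: cong_iff_dvd_diff)
    have k: "[s * int i + s' * int j
           + (2 * \<omega> * (s * int h + s' * int h' - int h'')) div int (nu n) = int k] (mod int (nu n))"
      using L(2) by (simp add: cong_iff_dvd_diff algebra_simps)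
    from fusion_two.ccc[OF s cong_sym[OF h] cong_sym[OF k]]
    show "fusion_two n \<omega> {#Prim_c h i, Prim_c h' j, Prim_c h'' k#}" .
  qed
  have "Q x y z"
    using assms(1-3) aaa ccc aac acc Q1[OF acc] Q2[OF aac] Q1[OF Q2[OF aac]] Q2[OF Q1[OF acc]]
    by (elim primK_cases) simp_all
  then show ?thesis using assms by (simp add: Q_def)
qed

lemma fusion_zero_if_nsol:
  assumes "primG n x" "primG n y" "primG n z" "\<Gamma>.nsol n (pointG x) (pointG y) (pointG z) \<noteq> 0"
  shows "fusion_zero n {#x, y, z#}"
proof -
  obtain l l' l'' where l: "x = Prim_d l" "y = Prim_d l'" "z = Prim_d l''"
    using assms(1-3) by (auto simp: primG_def)
  obtain s s' where s: "s \<in> {1, - 1 :: int}" "s' \<in> {1, - 1 :: int}"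
    and "int (mu n) dvd s * int l + s' * int l' - int l''"
    using assms(4) unfolding l pointG.simps G_nsol_iff by blast
  then have "[s * int l + s' * int l' = int l''] (mod int (mu n))" by (simp add: cong_iff_dvd_diff)
  from fusion_zero.ddd[OF s cong_sym[OF this]] show ?thesis unfolding l .
qed

lemma excess_table:
  assumes "x \<in> primaries n - {Prim_0}" "y \<in> primaries n - {Prim_0}" "z \<in> primaries n - {Prim_0}"
  shows "1 + excess n \<omega> x y z = (if fusion_two n \<omega> {#x, y, z#} then 2
                     else if fusion_zero n {#x, y, z#} then 0 else 1)"
proof (cases "excess n \<omega> x y z = 0")
  case True
  then have "\<not> fusion_two n \<omega> {#x, y, z#}" "\<not> fusion_zero n {#x, y, z#}"
    using fusion_two_excess[of n \<omega> x y z] fusion_zero_excess[of n x y z \<omega>] assms by auto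
  then show ?thesis using True by simp
next
  case False
  have "fusion_two n \<omega> {#x, y, z#} \<or> fusion_zero n {#x, y, z#}"
  proof -
    have "fusion_two n \<omega> {#Prim_b, p, p#}" if "primK n p" for p
      using that by (elim primK_cases) (auto intro: fusion_two.baa fusion_two.bcc)
    moreover have "fusion_zero n {#Prim_b, p, p#}" if "primG n p" for p
      using that by (auto simp: primG_def intro: fusion_zero.bdd)
    moreover have "fusion_two n \<omega> {#x, y, z#}" if "primK n x" "primK n y" "primK n z"
      using that False by (intro fusion_two_if_nsol) (auto simp: excess_K)
    moreover have "fusion_zero n {#x, y, z#}" if "primG n x" "primG n y" "primG n z"
      using that False by (intro fusion_zero_if_nsol) (auto simp: excess_G)
    ultimately show ?thesis using excess_nonzero_cases[OF False assms] by auto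
  qed
  then show ?thesis
    using fusion_two_excess[of n \<omega> x y z] fusion_zero_excess[of n x y z \<omega>] assms by auto
qed

section \<open>The modular data\<close>

lemma T_unit: "T_entry n \<omega> p * cnj (T_entry n \<omega> p) = 1"
  by (cases p) (simp_all add: T_values K.t_unit \<Gamma>.t_unit del: T_entry.simps(3-5))

lemma mat_pow_2: "mat_eq I (mat_pow I A 2) (mat_mult I A A)" if "finite I"
proof -
  have id: "(\<Sum>k\<in>I. A i k * mat_id k j) = A i j" if "j \<in> I" for i j
  proof -
    have "(\<Sum>k\<in>I. A i k * mat_id k j) = (\<Sum>k\<in>I. if k = j then A i k else 0)"
      by (intro sum.cong) (auto simp: mat_id_def)
    then show ?thesis using that \<open>finite I\<close> by simp
  qed
  show ?thesis
    by (auto simp: mat_eq_def numeral_2_eq_2 mat_mult_def id intro!: sum.cong)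
qed

lemma S_cnj: "cnj (S_mat n \<omega> p q) = S_mat n \<omega> p q"
  by (simp add: S_mat_def)

lemma S_pow_2:
  "p \<in> primaries n \<Longrightarrow> q \<in> primaries n \<Longrightarrow> mat_pow (primaries n) (S_mat n \<omega>) 2 p q = of_bool (p = q)"
  using mat_pow_2[OF finite_primaries, of n "S_mat n \<omega>"] S_squared[of p n q \<omega>]
  by (simp add: mat_eq_def mat_mult_def S_sym[of _ _ _ q])

lemma sum_delta_primaries:
  fixes F :: "primary \<Rightarrow> complex"
  assumes "p \<in> primaries n"
  shows "(\<Sum>l\<in>primaries n. F l * of_bool (l = p)) = F p"
    and "(\<Sum>l\<in>primaries n. of_bool (p = l) * F l) = F p"
proof -
  have "(\<Sum>l\<in>primaries n. F l * of_bool (l = p)) = (\<Sum>l\<in>primaries n. if l = p then F l else 0)"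
    "(\<Sum>l\<in>primaries n. of_bool (p = l) * F l) = (\<Sum>l\<in>primaries n. if l = p then F l else 0)"
    by (auto intro!: sum.cong)
  then show "(\<Sum>l\<in>primaries n. F l * of_bool (l = p)) = F p"
    "(\<Sum>l\<in>primaries n. of_bool (p = l) * F l) = F p"
    using assms finite_primaries by simp_all
qed

lemma charge_conj_id:
  assumes "p \<in> primaries n"
  shows "charge_conj (primaries n) (S_mat n \<omega>) p = p"
  unfolding charge_conj_def by (rule the_equality) (use assms in \<open>auto simp: S_pow_2\<close>)

lemma fusion_excess:
  "fusion (primaries n) Prim_0 (S_mat n \<omega>) x y z = of_bool (Prim_0 \<notin> {x, y, z}) + excess n \<omega> x y z"
  unfolding fusion_def S_cnj by (rule verlinde)

lemma S_0_nonzero: "S_mat n \<omega> Prim_0 l \<noteq> 0"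
proof -
  have "real (nu n) < sqrt (real (mu n))"
    by (rule real_less_rsqrt) (simp add: mu_eq_nu)
  then have "yy n < 1" "yy n > 0" by (simp_all add: yy_def)
  then have "S_block n \<omega> Prim_0 l \<noteq> 0" by (cases l) simp_all
  then show ?thesis by (simp add: S_mat_def)
qed

lemma fusion_0:
  assumes "x \<in> primaries n" "y \<in> primaries n"
  shows "fusion (primaries n) Prim_0 (S_mat n \<omega>) Prim_0 x y = of_bool (x = y)"
proof -
  have "fusion (primaries n) Prim_0 (S_mat n \<omega>) Prim_0 x y
      = (\<Sum>l\<in>primaries n. S_mat n \<omega> x l * S_mat n \<omega> y l)"
    unfolding fusion_def S_cnj by (intro sum.cong) (simp_all add: S_0_nonzero)
  then show ?thesis using S_squared[OF assms] by simp
qed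

lemma fusion_sym:
  "fusion (primaries n) Prim_0 (S_mat n \<omega>) x y z = fusion (primaries n) Prim_0 (S_mat n \<omega>) y x z"
  "fusion (primaries n) Prim_0 (S_mat n \<omega>) x y z = fusion (primaries n) Prim_0 (S_mat n \<omega>) x z y"
  unfolding fusion_def S_cnj by (simp_all add: mult_ac)

lemma fusion_nat:
  assumes "x \<in> primaries n" "y \<in> primaries n" "z \<in> primaries n"
  shows "fusion (primaries n) Prim_0 (S_mat n \<omega>) x y z \<in> \<nat>"
proof (cases "Prim_0 \<in> {x, y, z}")
  case True
  then consider "x = Prim_0" | "y = Prim_0" | "z = Prim_0" by auto
  then show ?thesis
  proof cases
    case 1
    then show ?thesis using assms by (simp add: fusion_0)
  next
    case 2
    then show ?thesis using assms fusion_sym(1)[of n \<omega> x y z] by (simp add: fusion_0)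
  next
    case 3
    then show ?thesis
      using assms fusion_sym(2)[of n \<omega> x y z] fusion_sym(1)[of n \<omega> x z y] by (simp add: fusion_0)
  qed
next
  case False
  then have "fusion (primaries n) Prim_0 (S_mat n \<omega>) x y z = 1 + excess n \<omega> x y z"
    by (simp add: fusion_excess)
  then show ?thesis using excess_table[of x n y z \<omega>] assms False by auto
qed

lemma ST_cubed:
  assumes "p \<in> primaries n" "q \<in> primaries n"
  shows "mat_pow (primaries n) (mat_mult (primaries n) (S_mat n \<omega>) (T_mat n \<omega>)) 3 p q = of_bool (p = q)"
proof -
  let ?\<Phi> = "primaries n" and ?T = "T_entry n \<omega>"
  let ?A = "mat_mult ?\<Phi> (S_mat n \<omega>) (T_mat n \<omega>)"
  have A: "?A p q = S_mat n \<omega> p q * ?T q" if "q \<in> ?\<Phi>" for p q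
  proof -
    have "?A p q = (\<Sum>l\<in>?\<Phi>. S_mat n \<omega> p l * ?T l * of_bool (l = q))"
      unfolding mat_mult_def by (intro sum.cong) (auto simp: T_mat_def)
    then show ?thesis using that by (simp add: sum_delta_primaries(1))
  qed
  have A2: "mat_pow ?\<Phi> ?A 2 p q = cnj (?T p) * S_mat n \<omega> p q" if "p \<in> ?\<Phi>" "q \<in> ?\<Phi>" for p q
  proof -
    have "mat_pow ?\<Phi> ?A 2 p q = (\<Sum>l\<in>?\<Phi>. ?A p l * ?A l q)"
      using mat_pow_2[OF finite_primaries, of n ?A] that by (simp add: mat_eq_def mat_mult_def)
    also have "\<dots> = (\<Sum>l\<in>?\<Phi>. S_mat n \<omega> p l * S_mat n \<omega> q l * ?T l) * ?T q"
      unfolding sum_distrib_right by (intro sum.cong) (use that in \<open>simp_all add: A S_sym[of _ _ _ q]\<close>)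
    also have "\<dots> = cnj (?T p) * S_mat n \<omega> p q * (?T q * cnj (?T q))"
      unfolding S_T_S by (simp add: mult_ac)
    finally show ?thesis by (simp add: T_unit)
  qed
  have "mat_pow ?\<Phi> ?A 3 p q = (\<Sum>l\<in>?\<Phi>. ?A p l * mat_pow ?\<Phi> ?A 2 l q)"
    by (simp add: numeral_3_eq_3 numeral_2_eq_2 mat_mult_def)
  also have "\<dots> = (\<Sum>l\<in>?\<Phi>. S_mat n \<omega> p l * S_mat n \<omega> q l)"
  proof (rule sum.cong[OF refl])
    fix l assume "l \<in> ?\<Phi>"
    then have "?A p l * mat_pow ?\<Phi> ?A 2 l q = S_mat n \<omega> p l * S_mat n \<omega> l q * (?T l * cnj (?T l))"
      using assms by (simp add: A A2 mult_ac)
    then show "?A p l * mat_pow ?\<Phi> ?A 2 l q = S_mat n \<omega> p l * S_mat n \<omega> q l"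
      unfolding T_unit by (simp add: S_sym[of _ _ l q])
  qed
  also have "\<dots> = of_bool (p = q)" using assms by (rule S_squared)
  finally show ?thesis .
qed

lemma S_pow_4:
  assumes "p \<in> primaries n" "q \<in> primaries n"
  shows "mat_pow (primaries n) (S_mat n \<omega>) 4 p q = of_bool (p = q)"
proof -
  let ?\<Phi> = "primaries n"
  have step: "mat_pow ?\<Phi> (S_mat n \<omega>) 3 l q = S_mat n \<omega> l q" if "l \<in> ?\<Phi>" for l
  proof -
    have "mat_pow ?\<Phi> (S_mat n \<omega>) 3 l q = (\<Sum>k\<in>?\<Phi>. S_mat n \<omega> l k * mat_pow ?\<Phi> (S_mat n \<omega>) 2 k q)"
      by (simp add: numeral_3_eq_3 numeral_2_eq_2 mat_mult_def)
    also have "\<dots> = (\<Sum>k\<in>?\<Phi>. S_mat n \<omega> l k * of_bool (k = q))"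
      by (intro sum.cong) (use assms in \<open>simp_all add: S_pow_2\<close>)
    finally show ?thesis using assms(2) by (simp add: sum_delta_primaries(1))
  qed
  have "mat_pow ?\<Phi> (S_mat n \<omega>) 4 p q = (\<Sum>l\<in>?\<Phi>. S_mat n \<omega> p l * mat_pow ?\<Phi> (S_mat n \<omega>) 3 l q)"
    by (simp add: eval_nat_numeral mat_mult_def)
  also have "\<dots> = (\<Sum>l\<in>?\<Phi>. S_mat n \<omega> p l * S_mat n \<omega> q l)"
    by (intro sum.cong) (simp_all add: step S_sym[of _ _ _ q])
  finally show ?thesis using S_squared[OF assms] by simp
qed

lemma T_unitary: "mat_unitary (primaries n) (T_mat n \<omega>)"
proof -
  have "(\<Sum>l\<in>primaries n. T_mat n \<omega> p l * cnj (T_mat n \<omega> q l)) = of_bool (p = q)"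
    "(\<Sum>l\<in>primaries n. cnj (T_mat n \<omega> l p) * T_mat n \<omega> l q) = of_bool (p = q)"
    if "p \<in> primaries n" "q \<in> primaries n" for p q
  proof -
    have "(\<Sum>l\<in>primaries n. T_mat n \<omega> p l * cnj (T_mat n \<omega> q l))
        = (\<Sum>l\<in>primaries n. of_bool (p = l) * of_bool (p = q))"
      by (intro sum.cong) (auto simp: T_mat_def T_unit)
    then show "(\<Sum>l\<in>primaries n. T_mat n \<omega> p l * cnj (T_mat n \<omega> q l)) = of_bool (p = q)"
      using that by (simp only: sum_delta_primaries(2))
    have "(\<Sum>l\<in>primaries n. cnj (T_mat n \<omega> l p) * T_mat n \<omega> l q)
        = (\<Sum>l\<in>primaries n. of_bool (p = l) * of_bool (p = q))"
      by (intro sum.cong) (auto simp: T_mat_def T_unit mult.commute[of "cnj _"])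
    then show "(\<Sum>l\<in>primaries n. cnj (T_mat n \<omega> l p) * T_mat n \<omega> l q) = of_bool (p = q)"
      using that by (simp only: sum_delta_primaries(2))
  qed
  then show ?thesis
    by (simp add: mat_unitary_def mat_eq_def mat_mult_def mat_adjoint_def mat_id_def)
qed

lemma modular_data_S_T: "modular_data (primaries n) Prim_0 (S_mat n \<omega>) (T_mat n \<omega>)"
  unfolding modular_data_def
proof (intro conjI ballI)
  let ?\<Phi> = "primaries n"
  show "finite ?\<Phi>" by (rule finite_primaries)
  show "Prim_0 \<in> ?\<Phi>" by (simp add: primaries_def)
  show "mat_unitary ?\<Phi> (S_mat n \<omega>)"
    using S_squared
    by (simp add: mat_unitary_def mat_eq_def mat_mult_def mat_adjoint_def mat_id_def S_cnj)
       (simp add: S_sym[of n \<omega>])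
  show "mat_unitary ?\<Phi> (T_mat n \<omega>)" by (rule T_unitary)
  show "mat_symmetric ?\<Phi> (S_mat n \<omega>)" by (simp add: mat_symmetric_def S_sym)
  show "mat_diagonal ?\<Phi> (T_mat n \<omega>)" by (simp add: mat_diagonal_def T_mat_def)
  show "mat_eq ?\<Phi> (mat_pow ?\<Phi> (S_mat n \<omega>) 2) (mat_pow ?\<Phi> (mat_mult ?\<Phi> (S_mat n \<omega>) (T_mat n \<omega>)) 3)"
    by (simp add: mat_eq_def S_pow_2 ST_cubed)
  show "mat_eq ?\<Phi> (mat_pow ?\<Phi> (S_mat n \<omega>) 4) mat_id"
    by (simp add: mat_eq_def S_pow_4 mat_id_def)
  show "mat_permutation ?\<Phi> (mat_pow ?\<Phi> (S_mat n \<omega>) 2)"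
    unfolding mat_permutation_def
    by (intro exI[of _ id]) (auto simp: S_pow_2)
next
  fix j assume "j \<in> primaries n"
  show "S_mat n \<omega> Prim_0 j \<in> \<real>" by (simp add: S_mat_def)
  show "S_mat n \<omega> Prim_0 j \<noteq> 0" by (rule S_0_nonzero)
next
  fix i j k assume "i \<in> primaries n" "j \<in> primaries n" "k \<in> primaries n"
  then show "fusion (primaries n) Prim_0 (S_mat n \<omega>) i j k \<in> \<nat>" by (rule fusion_nat)
qed

theorem mainTheorem1:
  fixes n :: nat and \<omega> :: int
  shows
    "modular_data (primaries n) Prim_0 (S_mat n \<omega>) (T_mat n \<omega>) \<and>
     mat_eq (primaries n) (mat_pow (primaries n) (S_mat n \<omega>) 2) mat_id \<and>
     (let \<Phi> = primaries n; N = fusion3 \<Phi> Prim_0 (S_mat n \<omega>) in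
       (\<forall>x\<in>\<Phi>. \<forall>y\<in>\<Phi>. \<forall>z\<in>\<Phi>. N x y z = N y x z \<and> N x y z = N x z y) \<and>
       (\<forall>x\<in>\<Phi>. \<forall>y\<in>\<Phi>. N Prim_0 x y = (if x = y then 1 else 0)) \<and>
       (\<forall>x\<in>\<Phi> - {Prim_0}. \<forall>y\<in>\<Phi> - {Prim_0}. \<forall>z\<in>\<Phi> - {Prim_0}.
          N x y z = (if fusion_two n \<omega> {#x, y, z#} then 2
                     else if fusion_zero n {#x, y, z#} then 0
                     else 1)))"
proof -
  let ?N = "fusion (primaries n) Prim_0 (S_mat n \<omega>)"
    and ?N3 = "fusion3 (primaries n) Prim_0 (S_mat n \<omega>)"
  have N: "?N3 x y z = ?N x y z" if "z \<in> primaries n" for x y z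
    using that by (simp add: fusion3_def charge_conj_id)
  show ?thesis
    unfolding Let_def
  proof (intro conjI ballI)
    show "modular_data (primaries n) Prim_0 (S_mat n \<omega>) (T_mat n \<omega>)" by (rule modular_data_S_T)
    show "mat_eq (primaries n) (mat_pow (primaries n) (S_mat n \<omega>) 2) mat_id"
      by (simp add: mat_eq_def S_pow_2 mat_id_def)
  next
    fix x y z assume "x \<in> primaries n" "y \<in> primaries n" "z \<in> primaries n"
    then show "?N3 x y z = ?N3 y x z" "?N3 x y z = ?N3 x z y"
      using fusion_sym[of n \<omega> x y z] by (simp_all add: N)
  next
    fix x y assume "x \<in> primaries n" "y \<in> primaries n"
    then show "?N3 Prim_0 x y = (if x = y then 1 else 0)" by (simp add: N fusion_0)
  next
    fix x y z assume xyz: "x \<in> primaries n - {Prim_0}" "y \<in> primaries n - {Prim_0}" "z \<in> primaries n - {Prim_0}"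
    then have "?N3 x y z = 1 + excess n \<omega> x y z" by (auto simp: N fusion_excess)
    then show "?N3 x y z = (if fusion_two n \<omega> {#x, y, z#} then 2
                     else if fusion_zero n {#x, y, z#} then 0 else 1)"
      unfolding excess_table[OF xyz] .
  qed
qed

end
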